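(* Let $n,m\in\mathbb{N}$, let $t_0\in\mathbb{N}$, and let $f_1,\dots,f_n:\mathbb{R}^m\to\mathbb{R}$ with $F(z)=\sum_{i=1}^n f_i(z)$. Assume: (1) Objective: (a) each $f_i$ is convex on $\mathbb{R}^m$; (b) the set $\mathcal{Z}=\arg\min_{z\in\mathbb{R}^m}F(z)$ is non-empty; (c) there are constants $L_1,\dots,L_n$ such that $\|g\|\le L_i$ for all $i\in[n]$, all $z\in\mathbb{R}^m$ and all subgradients $g$ of $f_i$ at $z$. (2) Stochasticity: $\{W(t)\}$ is a sequence of random $n\times n$ matrices adapted to a filtration $\{\mathcal{F}(t)\}$ such that (a) for all $t\ge t_0$, $W(t)$ is row-stochastic almost surely; (b) for every $t>t_0$, $\mathbb{E}[W(t)\mid\mathcal{F}(t-1)]$ is column-stochastic almost surely. (3) Conditional $B$-connectivity (for a fixed $\gamma\in(0,1)$): for all $t\ge t_0$, (a) every node of the graph $\mathcal{G}(W(t))$ has a self-loop almost surely; (b) there is an integer $B>0$, independent of $t$, such that the random graph $([n],\mathcal{E}_B(t))$ with $$\mathcal{E}_B(t)=\bigcup_{\tau=tB+1}^{(t+1)B}\mathcal{E}\big(\mathbb{E}[W(\tau)\mid\mathcal{F}(tB)]\big)$$ has a spanning rooted tree almost surely. (4) Step-size: $\{\alpha(t)\}_{t\ge t_0}$ is a deterministic real sequence with $0<\alpha(t)\le Kt^{-\beta}$ for some $K,\beta>0$ and all $t\ge t_0$, $\lim_{t\to\infty}\frac{\alpha(t)}{\alpha(t+1)}=1$, $\sum_{t=t_0}^\infty\alpha(t)=\infty$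 and $\sum_{t=t_0}^\infty\alpha^2(t)<\infty$. For arbitrary (deterministic) initial conditions $\mathbf{x}_i(t_0)\in\mathbb{R}^m$, $i\in[n]$, let $$\mathbf{x}_i(t+1)=\sum_{j=1}^n w_{ij}(t+1)\mathbf{x}_j(t)-\alpha(t)\mathbf{g}_i(t),\qquad t\ge t_0,\ i\in[n],$$ where $\mathbf{g}_i(t)$ is an $\mathcal{F}(t)$-measurable random vector that is a subgradient of $f_i$ at $\mathbf{x}_i(t)$. Then there is a random vector $z^*$ with values in $\mathcal{Z}$ almost surely such that, almost surely, $\lim_{t\to\infty}\mathbf{x}_i(t)=z^*$ for all $i\in[n]$.
   Context: $[n]=\{1,\dots,n\}$, and $\|\cdot\|$ is the $\ell_\infty$ norm on $\mathbb{R}^m$. All random objects live on a probability space $(\Omega,\mathcal{F},\mathrm{Pr})$; a filtration is an increasing sequence $\mathcal{F}(0)\subseteq\mathcal{F}(1)\subseteq\cdots\subseteq\mathcal{F}$ of sigma-algebras, and $\{W(t)\}$ is adapted if $W(t)$ is $\mathcal{F}(t)$-measurable for every $t$. A non-negative matrix $A$ is row-stochastic if $Ae=e$ and column-stochastic if $e^TA=e^T$, where $e$ is the all-one vector. A vector $g$ is a subgradient of $f$ at $\hat x$ if $f(x)-f(\hat x)\ge\langle g,x-\hat x\rangle$ for all $x\in\mathbb{R}^m$ (standard inner product). A constant $\gamma\in(0,1)$ is fixed. For an $n\times n$ matrix $A=[a_{ij}]$, $\mathcal{G}(A)=([n],\mathcal{E}(A))$ is the directed graph with edge set $\mathcal{E}(A)=\{(j,i):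 i,j\in[n],\ a_{ij}>\gamma\}$. A directed graph on $[n]$ has a spanning rooted tree if there is a vertex $r$ from which there is a directed path to every other vertex. *)

theory Defs
  imports "HOL-Probability.Probability"
begin

definition row_stochastic :: "real^'n^'n \<Rightarrow> bool" where
  "row_stochastic A \<longleftrightarrow> (\<forall>i j. 0 \<le> A $ i $ j) \<and> A *v 1 = 1"

definition column_stochastic :: "real^'n^'n \<Rightarrow> bool" where
  "column_stochastic A \<longleftrightarrow> (\<forall>i j. 0 \<le> A $ i $ j) \<and> 1 v* A = 1"

definition subgradient :: "('b::real_inner \<Rightarrow> real) \<Rightarrow> 'b \<Rightarrow> 'b \<Rightarrow> bool" where
  "subgradient f z g \<longleftrightarrow> (\<forall>x. f x - f z \<ge> g \<bullet> (x - z))"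

text \<open>A positive weight in row \<open>i\<close>, column \<open>j\<close> means that \<open>i\<close> listens to \<open>j\<close>, hence the edge
  points from \<open>j\<close> to \<open>i\<close>.\<close>

definition edges :: "real \<Rightarrow> real^'n^'n \<Rightarrow> ('n \<times> 'n) set" where
  "edges \<gamma> A = {(j, i). A $ i $ j > \<gamma>}"

definition has_spanning_rooted_tree :: "('n \<times> 'n) set \<Rightarrow> bool" where
  "has_spanning_rooted_tree E \<longleftrightarrow> (\<exists>r. \<forall>v. v \<noteq> r \<longrightarrow> (r, v) \<in> E\<^sup>+)"

definition matrix_cond_exp ::
    "'a measure \<Rightarrow> 'a measure \<Rightarrow> ('a \<Rightarrow> real^'n^'n) \<Rightarrow> 'a \<Rightarrow> real^'n^'n" where
  "matrix_cond_exp M G X \<omega> = (\<chi> i j. real_cond_exp M G (\<lambda>\<omega>'. X \<omega>' $ i $ j) \<omega>)"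

end

(* The dispersion D(t), the sum of |x_i(t) - x_j(t)|^2 over all i, j, is a Lyapunov function of the
   averaging: the column sums of the conditional expectations are 1, so the strict convexity of the
   square turns the expected energy of the edges in use into a decrease of E D.  The state of a
   window of length B is close to its initial state unless energy has been dissipated, and the
   initial state is known when the expected graph of the window is, so a spanning tree of that graph
   bounds E D at the start of the window by the dissipation.  Hence E D contracts geometrically, up
   to an error of the order of the squared step sizes, and the sum of all E D(t) is finite.

   For a minimizer z, the sum over i of |x_i(t) - z|^2 is then a nonnegative almost supermartingale
   with summable errors alpha(t)^2 + D(t), so by Robbins-Siegmund it converges and the sum of
   alpha(t) (F(x_i(t)) - min F) is finite, almost surely.  Doing this for a countable dense set of
   minimizers forces all x_i along a sample path to a single minimizer. *)

theory Submission imports Defs begin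

text \<open>The obstacle is that connectivity concerns matrices averaged over everything after the
  start of a window. A realized window may contain no spanning tree, so a sample path need not
  contract over it, and the contraction holds for the expected dispersion only. Conditional weights
  can be tested only against the state known at the start of the window, while the dissipation is
  paid at the moving state; passing from one to the other costs a factor quadratic in B. Likewise,
  as only the conditional column sums are 1, the mean of the nodes is random. Under averaging the
  expected square of the sum of the nodes cannot decrease, however, and this sum enters the
  dispersion with a negative sign.

  In the drift towards a minimizer, disagreement appears as alpha(t) sqrt(D(t)), which is bounded by
  a multiple of alpha(t)^2 + D(t). This is why summability of E D(t) is the right target. All
  integrability claims rest on the deterministic start: each iterate is almost surely bounded, by a
  constant that may depend on the time.\<close>

subsection \<open>Almost sure convergence of supermartingales\<close>

lemma AE_summable_of_summable_integral:
  fixes h :: "nat \<Rightarrow> 'a \<Rightarrow> real"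
  assumes int: "\<And>t. integrable M (h t)"
    and nonneg: "\<And>t. AE \<omega> in M. 0 \<le> h t \<omega>"
    and summable: "summable (\<lambda>t. \<integral>\<omega>. h t \<omega> \<partial>M)"
  shows "AE \<omega> in M. summable (\<lambda>t. h t \<omega>)"
proof -
  have [measurable]: "\<And>t. h t \<in> borel_measurable M"
    using int by auto
  have "(\<integral>\<^sup>+ \<omega>. (\<Sum>t. ennreal (h t \<omega>)) \<partial>M) = (\<Sum>t. \<integral>\<^sup>+ \<omega>. ennreal (h t \<omega>) \<partial>M)"
    by (rule nn_integral_suminf) measurable
  also have "\<dots> = (\<Sum>t. ennreal (\<integral>\<omega>. h t \<omega> \<partial>M))"
    using nn_integral_eq_integral[OF int nonneg] by simp
  also have "\<dots> < \<infinity>"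
    using summable integral_nonneg_AE[OF nonneg] by (simp add: suminf_ennreal2 top.not_eq_extremum)
  finally have "AE \<omega> in M. (\<Sum>t. ennreal (h t \<omega>)) \<noteq> \<infinity>"
    by (intro nn_integral_noteq_infinite) auto
  moreover have "AE \<omega> in M. \<forall>t. 0 \<le> h t \<omega>"
    using nonneg by (simp add: AE_all_countable)
  ultimately show ?thesis
    by eventually_elim (auto intro!: summable_suminf_not_top)
qed

text \<open>The strategy of the upcrossing inequality: buy when the price drops below \<open>a\<close> and sell
  when it has reached \<open>b\<close>.  At time \<open>k\<close> one unit is owned iff \<open>holding a b u k\<close>.\<close>

primrec holding :: "real \<Rightarrow> real \<Rightarrow> (nat \<Rightarrow> real) \<Rightarrow> nat \<Rightarrow> bool" where
  "holding a b u 0 \<longleftrightarrow> False"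
| "holding a b u (Suc k) \<longleftrightarrow> (if holding a b u k then u k < b else u k < a)"

definition sells :: "real \<Rightarrow> real \<Rightarrow> (nat \<Rightarrow> real) \<Rightarrow> nat \<Rightarrow> bool" where
  "sells a b u k \<longleftrightarrow> holding a b u k \<and> b \<le> u k"

text \<open>Every finished round was bought below \<open>a\<close> and sold at \<open>b\<close> or
  above, and a unit still owned at time \<open>k\<close> was bought below \<open>a\<close>; the
  invariant counts it at its current price. Ownership over the step from \<open>j\<close> to
  \<open>Suc j\<close> is decided by the prices up to \<open>j\<close>.\<close>

lemma sells_gain:
  assumes "a < b"
  shows "(b - a) * (\<Sum>j<k. of_bool (sells a b u j)) + (if holding a b u k then u k - a else 0)
    \<le> (\<Sum>j<k. of_bool (holding a b u (Suc j)) * (u (Suc j) - u j))"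
proof (induction k)
  case (Suc k)
  define S where "S = (\<Sum>j<k. of_bool (sells a b u j) :: real)"
  define T where "T = (\<Sum>j<k. of_bool (holding a b u (Suc j)) * (u (Suc j) - u j))"
  have "(b - a) * S + (if holding a b u k then u k - a else 0) \<le> T"
    using Suc unfolding S_def T_def .
  then show ?case
    unfolding sum.lessThan_Suc S_def[symmetric] T_def[symmetric]
    using assms by (auto simp: sells_def distrib_left split: if_splits)
qed simp

text \<open>After the last sale, a unit bought below \<open>a\<close> would be kept forever, which
  forces the price to stay below \<open>b\<close>.\<close>

lemma frequently_crossing_sells:
  assumes "a < b" and low: "\<exists>\<^sub>F k in sequentially. u k < a"
    and high: "\<exists>\<^sub>F k in sequentially. b < u k"
  shows "\<exists>\<^sub>F k in sequentially. sells a b u k"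
proof (rule ccontr)
  assume "\<not> ?thesis"
  then obtain k0 where k0: "\<And>k. k \<ge> k0 \<Longrightarrow> \<not> sells a b u k"
    by (auto simp: frequently_def eventually_sequentially)
  obtain k where k: "k \<ge> k0" "u k < a"
    using low by (auto simp: frequently_sequentially)
  have "holding a b u (Suc k + m)" for m
  proof (induction m)
    case 0
    show ?case using k assms(1) by auto
  next
    case (Suc m)
    then show ?case using k0[of "Suc k + m"] k by (auto simp: sells_def)
  qed
  then have "u (Suc k + m) < b" for m
    using k0[of "Suc k + m"] k(1) by (force simp: sells_def)
  moreover obtain l where "l \<ge> Suc k" "b < u l"
    using high by (auto simp: frequently_sequentially)
  ultimately show False
    by (metis le_add_diff_inverse not_less_iff_gr_or_eq)
qed

text \<open>A gap between liminf and limsup would contain two rationals that the sequence crosses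
  infinitely often, so a limit exists in the extended reals. Returning infinitely often to a bounded
  set makes it finite. Rational levels keep the number of exceptional sets countable.\<close>

lemma convergent_of_no_crossing:
  fixes u :: "nat \<Rightarrow> real"
  assumes bounded: "\<exists>\<^sub>F k in sequentially. \<bar>u k\<bar> < R"
    and no_crossing: "\<And>p q :: rat. p < q \<Longrightarrow>
      \<not> ((\<exists>\<^sub>F k in sequentially. u k < of_rat p) \<and> (\<exists>\<^sub>F k in sequentially. of_rat q < u k))"
  shows "convergent u"
proof -
  define X where "X = (\<lambda>k. ereal (u k))"
  have "limsup X \<le> liminf X"
  proof (rule ccontr)
    assume "\<not> limsup X \<le> liminf X"
    then obtain p :: rat where p: "liminf X < real_of_rat p" "real_of_rat p < limsup X"
      using ereal_dense3[of "liminf X" "limsup X"] by (auto simp: not_le)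
    obtain q :: rat where q: "ereal (real_of_rat p) < real_of_rat q" "real_of_rat q < limsup X"
      using ereal_dense3[OF p(2)] by auto
    have "\<exists>\<^sub>F k in sequentially. u k < of_rat p"
    proof (rule ccontr)
      assume "\<not> ?thesis"
      then have "real_of_rat p \<le> liminf X"
        by (intro Liminf_bounded) (auto simp: frequently_def X_def not_less)
      with p(1) show False by simp
    qed
    moreover have "\<exists>\<^sub>F k in sequentially. of_rat q < u k"
    proof (rule ccontr)
      assume "\<not> ?thesis"
      then have "limsup X \<le> real_of_rat q"
        by (intro Limsup_bounded) (auto simp: frequently_def X_def not_less)
      with q(2) show False by simp
    qed
    ultimately show False
      using no_crossing[of p q] q(1) by (simp add: of_rat_less)
  qed
  then have lim: "X \<longlonglongrightarrow> liminf X"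
    by (intro Liminf_eq_Limsup) (auto intro!: antisym Liminf_le_Limsup)
  have "liminf X \<noteq> \<infinity>"
  proof
    assume "liminf X = \<infinity>"
    with lim have "\<forall>\<^sub>F k in sequentially. ereal R < X k"
      by (simp add: tendsto_PInfty)
    then have "\<forall>\<^sub>F k in sequentially. \<not> \<bar>u k\<bar> < R"
      by eventually_elim (auto simp: X_def)
    with bounded show False by (simp add: frequently_def)
  qed
  moreover have "liminf X \<noteq> -\<infinity>"
  proof
    assume "liminf X = -\<infinity>"
    with lim have "\<forall>\<^sub>F k in sequentially. X k < ereal (-R)"
      by (simp only: tendsto_MInfty)
    then have "\<forall>\<^sub>F k in sequentially. \<not> \<bar>u k\<bar> < R"
      by eventually_elim (auto simp: X_def)
    with bounded show False by (simp add: frequently_def)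
  qed
  ultimately obtain l where "liminf X = ereal l"
    by (cases "liminf X") auto
  then show ?thesis
    using lim by (auto simp: X_def convergent_def)
qed

text \<open>The supermartingale property is stated in integrated form, which avoids conditional
  expectations.\<close>

locale integrated_supermartingale = prob_space M for M :: "'a measure" +
  fixes F :: "nat \<Rightarrow> 'a measure" and X :: "nat \<Rightarrow> 'a \<Rightarrow> real" and C :: real
  assumes subalg: "\<And>t. subalgebra M (F t)"
    and mono: "\<And>s t. s \<le> t \<Longrightarrow> sets (F s) \<subseteq> sets (F t)"
    and adapted: "\<And>t. X t \<in> borel_measurable (F t)"
    and int: "\<And>t. integrable M (X t)"
    and super: "\<And>t A. A \<in> sets (F t) \<Longrightarrow>
      (\<integral>\<omega>. indicator A \<omega> * X (Suc t) \<omega> \<partial>M) \<le> (\<integral>\<omega>. indicator A \<omega> * X t \<omega> \<partial>M)"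
    and bounded: "\<And>t. (\<integral>\<omega>. max 0 (- X t \<omega>) \<partial>M) \<le> C"
begin

text \<open>Ownership during the step after time \<open>k\<close> is an event known at time
  \<open>k\<close>, so \<open>super\<close> can be applied to it.\<close>

lemma holding_measurable: "{\<omega> \<in> space M. holding a b (\<lambda>k. X k \<omega>) (Suc k)} \<in> sets (F k)"
proof (induction k)
  case 0
  have "space M = space (F 0)"
    using subalg by (auto simp: subalgebra_def)
  then show ?case using adapted[of 0] by simp
next
  case (Suc k)
  have *: "space M = space (F (Suc k))"
    using subalg by (auto simp: subalgebra_def)
  have [measurable]: "Measurable.pred (F (Suc k)) (\<lambda>\<omega>. holding a b (\<lambda>k. X k \<omega>) (Suc k))"
    using subsetD[OF mono[of k "Suc k"] Suc] unfolding * pred_def by simp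
  have [measurable]: "X (Suc k) \<in> borel_measurable (F (Suc k))"
    by (rule adapted)
  show ?case unfolding * holding.simps(2)[of _ _ _ "Suc k"] by measurable
qed

lemma integrable_indicator_mult:
  "A \<in> sets M \<Longrightarrow> integrable M f \<Longrightarrow> integrable M (\<lambda>\<omega>. indicator A \<omega> * (f \<omega> :: real))"
  using integrable_mult_indicator[of A M f] by simp

text \<open>Doob's upcrossing argument: the gain \<open>G k\<close> of the strategy has nonpositive
  expectation, yet by \<open>sells_gain\<close> it is at least \<open>b - a\<close> per sale, up to
  the loss on an open position. That loss is at most \<open>\<bar>a\<bar>\<close> plus the negative
  part of \<open>X k\<close>, whose expectation is bounded by \<open>C\<close>. So the expected
  number of sales is bounded uniformly in \<open>k\<close>.\<close>

lemma sells_summable: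
  assumes "a < b"
  shows "AE \<omega> in M. summable (\<lambda>k. of_bool (sells a b (\<lambda>k. X k \<omega>) k) :: real)"
proof (rule AE_summable_of_summable_integral)
  define H where "H k = {\<omega> \<in> space M. holding a b (\<lambda>k. X k \<omega>) (Suc k)}" for k
  have HF: "H k \<in> sets (F k)" for k
    unfolding H_def by (rule holding_measurable)
  then have HM [measurable]: "H k \<in> sets M" for k
    using subalg[of k] by (auto simp: subalgebra_def)
  have [measurable]: "X k \<in> borel_measurable M" for k
    using int by auto
  have [measurable]: "Measurable.pred M (\<lambda>\<omega>. holding a b (\<lambda>k. X k \<omega>) k)" for k
    using HM unfolding H_def by (cases k) (simp_all add: pred_def)
  show sells_int: "integrable M (\<lambda>\<omega>. of_bool (sells a b (\<lambda>k. X k \<omega>) k) :: real)" for k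
    by (rule integrable_const_bound[where B = 1]) (auto simp: sells_def)
  define G where "G k \<omega> = (\<Sum>j<k. indicator (H j) \<omega> * (X (Suc j) \<omega> - X j \<omega>))" for k \<omega>
  have G_int: "integrable M (G k)" for k
    unfolding G_def by (intro Bochner_Integration.integrable_sum integrable_indicator_mult
        HM Bochner_Integration.integrable_diff int)
  have gain: "(b - a) * (\<Sum>j<k. of_bool (sells a b (\<lambda>k. X k \<omega>) j))
      \<le> G k \<omega> + (\<bar>a\<bar> + max 0 (- X k \<omega>))" if "\<omega> \<in> space M" for k \<omega>
  proof -
    have "G k \<omega> = (\<Sum>j<k. of_bool (holding a b (\<lambda>k. X k \<omega>) (Suc j)) * (X (Suc j) \<omega> - X j \<omega>))"
      unfolding G_def using that by (intro sum.cong) (auto simp: H_def indicator_def)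
    with sells_gain[OF assms, of "\<lambda>k. X k \<omega>" k] show ?thesis
      by (simp del: sum_of_bool_mult_eq sum_mult_of_bool_eq sum_of_bool_eq split: if_splits)
  qed
  have "(\<integral>\<omega>. G k \<omega> \<partial>M) \<le> 0" for k
  proof -
    have "(\<integral>\<omega>. G k \<omega> \<partial>M) = (\<Sum>j<k. \<integral>\<omega>. indicator (H j) \<omega> * (X (Suc j) \<omega> - X j \<omega>) \<partial>M)"
      unfolding G_def by (intro Bochner_Integration.integral_sum integrable_indicator_mult
        HM Bochner_Integration.integrable_diff int)
    also have "\<dots> = (\<Sum>j<k. (\<integral>\<omega>. indicator (H j) \<omega> * X (Suc j) \<omega> \<partial>M)
        - (\<integral>\<omega>. indicator (H j) \<omega> * X j \<omega> \<partial>M))"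
      by (simp add: right_diff_distrib integrable_indicator_mult int)
    also have "\<dots> \<le> 0"
      using super[OF HF] by (intro sum_nonpos) simp
    finally show ?thesis .
  qed
  then have bound: "(b - a) * (\<Sum>j<k. \<integral>\<omega>. of_bool (sells a b (\<lambda>k. X k \<omega>) j) \<partial>M) \<le> \<bar>a\<bar> + C" for k
  proof -
    have "(b - a) * (\<Sum>j<k. \<integral>\<omega>. of_bool (sells a b (\<lambda>k. X k \<omega>) j) \<partial>M)
        = (\<integral>\<omega>. (b - a) * (\<Sum>j<k. of_bool (sells a b (\<lambda>k. X k \<omega>) j)) \<partial>M)"
      using sells_int by (simp add: Bochner_Integration.integral_sum del: sum_of_bool_eq)
    also have "\<dots> \<le> (\<integral>\<omega>. G k \<omega> + (\<bar>a\<bar> + max 0 (- X k \<omega>)) \<partial>M)"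
      using sells_int G_int int gain by (intro integral_mono) (auto simp del: sum_of_bool_eq)
    also have "\<dots> = (\<integral>\<omega>. G k \<omega> \<partial>M) + (\<bar>a\<bar> + (\<integral>\<omega>. max 0 (- X k \<omega>) \<partial>M))"
      using G_int int by (simp add: prob_space)
    also have "\<dots> \<le> \<bar>a\<bar> + C"
      using bounded[of k] \<open>(\<integral>\<omega>. G k \<omega> \<partial>M) \<le> 0\<close> by simp
    finally show ?thesis .
  qed
  show "summable (\<lambda>k. \<integral>\<omega>. of_bool (sells a b (\<lambda>k. X k \<omega>) k) \<partial>M :: real)"
  proof (rule summableI_nonneg_bounded)
    show "(\<Sum>j<k. \<integral>\<omega>. of_bool (sells a b (\<lambda>k. X k \<omega>) j) \<partial>M) \<le> (\<bar>a\<bar> + C) / (b - a)" for k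
      using bound[of k] assms by (simp add: pos_le_divide_eq mult.commute)
  qed simp
qed simp

text \<open>The absolute value is the variable plus twice its negative part, so the first absolute
  moments are bounded in time; by Fatou the liminf of the absolute values is almost surely
  finite.\<close>

lemma frequently_bounded: "AE \<omega> in M. \<exists>R. \<exists>\<^sub>F k in sequentially. \<bar>X k \<omega>\<bar> < R"
proof -
  have [measurable]: "X k \<in> borel_measurable M" for k
    using int by auto
  have decreasing: "(\<integral>\<omega>. X k \<omega> \<partial>M) \<le> (\<integral>\<omega>. X 0 \<omega> \<partial>M)" for k
  proof (induction k)
    case (Suc k)
    have *: "space M \<in> sets (F k)"
      using subalg[of k] sets.top[of "F k"] by (simp add: subalgebra_def)
    have "(\<integral>\<omega>. indicator (space M) \<omega> * X j \<omega> \<partial>M) = (\<integral>\<omega>. X j \<omega> \<partial>M)" for j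
      by (rule Bochner_Integration.integral_cong) auto
    with super[OF *] Suc show ?case by simp
  qed simp
  define K where "K = (\<integral>\<omega>. X 0 \<omega> \<partial>M) + 2 * C"
  have abs_bound: "(\<integral>\<^sup>+ \<omega>. ennreal \<bar>X k \<omega>\<bar> \<partial>M) \<le> ennreal K" for k
  proof -
    have "(\<integral>\<omega>. \<bar>X k \<omega>\<bar> \<partial>M) = (\<integral>\<omega>. X k \<omega> + 2 * max 0 (- X k \<omega>) \<partial>M)"
      by (rule Bochner_Integration.integral_cong) auto
    also have "\<dots> = (\<integral>\<omega>. X k \<omega> \<partial>M) + 2 * (\<integral>\<omega>. max 0 (- X k \<omega>) \<partial>M)"
      using int by simp
    also have "\<dots> \<le> K"
      using decreasing[of k] bounded[of k] by (simp add: K_def)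
    finally show ?thesis
      using int by (simp add: nn_integral_eq_integral ennreal_leI)
  qed
  have "(\<integral>\<^sup>+ \<omega>. liminf (\<lambda>k. ennreal \<bar>X k \<omega>\<bar>) \<partial>M) \<le> liminf (\<lambda>k. \<integral>\<^sup>+ \<omega>. ennreal \<bar>X k \<omega>\<bar> \<partial>M)"
    by (rule nn_integral_liminf) measurable
  also have "\<dots> \<le> limsup (\<lambda>k. \<integral>\<^sup>+ \<omega>. ennreal \<bar>X k \<omega>\<bar> \<partial>M)"
    by (rule Liminf_le_Limsup) simp
  also have "\<dots> \<le> ennreal K"
    by (rule Limsup_bounded) (simp add: abs_bound)
  also have "\<dots> < \<infinity>" by simp
  finally have "AE \<omega> in M. liminf (\<lambda>k. ennreal \<bar>X k \<omega>\<bar>) \<noteq> \<infinity>"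
    by (intro nn_integral_noteq_infinite) auto
  then show ?thesis
  proof eventually_elim
    case (elim \<omega>)
    then obtain R where R: "liminf (\<lambda>k. ennreal \<bar>X k \<omega>\<bar>) = ennreal R" "0 \<le> R"
      by (cases "liminf (\<lambda>k. ennreal \<bar>X k \<omega>\<bar>)") auto
    have "\<exists>\<^sub>F k in sequentially. \<bar>X k \<omega>\<bar> < R + 1"
    proof (rule ccontr)
      assume "\<not> ?thesis"
      then have "ennreal (R + 1) \<le> liminf (\<lambda>k. ennreal \<bar>X k \<omega>\<bar>)"
        by (intro Liminf_bounded) (auto simp: frequently_def not_less intro: ennreal_leI)
      with R show False by (simp add: ennreal_le_iff)
    qed
    then show ?case ..
  qed
qed

theorem AE_convergent: "AE \<omega> in M. convergent (\<lambda>k. X k \<omega>)"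
proof -
  have "AE \<omega> in M. \<forall>p q :: rat. p < q \<longrightarrow>
      summable (\<lambda>k. of_bool (sells (of_rat p) (of_rat q) (\<lambda>k. X k \<omega>) k) :: real)"
    using sells_summable by (auto simp: AE_all_countable of_rat_less)
  with frequently_bounded show ?thesis
  proof eventually_elim
    case (elim \<omega>)
    then obtain R where R: "\<exists>\<^sub>F k in sequentially. \<bar>X k \<omega>\<bar> < R" by blast
    show ?case
    proof (rule convergent_of_no_crossing[OF R], rule notI)
      fix p q :: rat
      assume "p < q" and cross: "(\<exists>\<^sub>F k in sequentially. X k \<omega> < of_rat p) \<and>
        (\<exists>\<^sub>F k in sequentially. of_rat q < X k \<omega>)"
      have "(\<lambda>k. of_bool (sells (of_rat p) (of_rat q) (\<lambda>k. X k \<omega>) k) :: real) \<longlonglongrightarrow> 0"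
        using elim(2) \<open>p < q\<close> by (intro summable_LIMSEQ_zero) auto
      then have "\<forall>\<^sub>F k in sequentially.
          (of_bool (sells (of_rat p) (of_rat q) (\<lambda>k. X k \<omega>) k) :: real) < 1"
        by (rule order_tendstoD) simp
      then have "\<forall>\<^sub>F k in sequentially. \<not> sells (of_rat p) (of_rat q) (\<lambda>k. X k \<omega>) k"
        by eventually_elim auto
      moreover have "\<exists>\<^sub>F k in sequentially. sells (of_rat p) (of_rat q) (\<lambda>k. X k \<omega>) k"
        using cross \<open>p < q\<close> by (intro frequently_crossing_sells) (auto simp: of_rat_less)
      ultimately show False by (simp add: frequently_def)
    qed
  qed
qed

end

text \<open>Adding the past \<open>b\<close> and subtracting the past \<open>c\<close> turns
  \<open>V\<close> into a supermartingale whose negative part is at most the sum of the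
  \<open>c\<close>. Once this converges and \<open>c\<close> is summable along the path,
  \<open>V\<close> plus the partial sums of \<open>b\<close> converges; as \<open>V\<close> is
  nonnegative the partial sums are bounded, hence convergent, and \<open>V\<close> converges
  too.\<close>

lemma (in prob_space) robbins_siegmund:
  fixes F :: "nat \<Rightarrow> 'a measure" and V b c :: "nat \<Rightarrow> 'a \<Rightarrow> real"
  assumes subalg: "\<And>t. subalgebra M (F t)"
    and mono: "\<And>s t. s \<le> t \<Longrightarrow> sets (F s) \<subseteq> sets (F t)"
    and adapted: "\<And>t. V t \<in> borel_measurable (F t)" "\<And>t. b t \<in> borel_measurable (F t)"
      "\<And>t. c t \<in> borel_measurable (F t)"
    and integrable: "\<And>t. integrable M (V t)" "\<And>t. integrable M (b t)" "\<And>t. integrable M (c t)"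
    and nonneg: "\<And>t \<omega>. 0 \<le> V t \<omega>" "\<And>t \<omega>. 0 \<le> b t \<omega>" "\<And>t \<omega>. 0 \<le> c t \<omega>"
    and drift: "\<And>t A. A \<in> sets (F t) \<Longrightarrow>
      (\<integral>\<omega>. indicator A \<omega> * V (Suc t) \<omega> \<partial>M)
        \<le> (\<integral>\<omega>. indicator A \<omega> * (V t \<omega> - b t \<omega> + c t \<omega>) \<partial>M)"
    and summable: "summable (\<lambda>t. \<integral>\<omega>. c t \<omega> \<partial>M)"
  shows "AE \<omega> in M. convergent (\<lambda>t. V t \<omega>) \<and> summable (\<lambda>t. b t \<omega>)"
proof -
  define X where "X t \<omega> = V t \<omega> + (\<Sum>s<t. b s \<omega> - c s \<omega>)" for t \<omega>
  have X_int: "integrable M (X t)" for t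
    unfolding X_def by (intro Bochner_Integration.integrable_add Bochner_Integration.integrable_sum
        Bochner_Integration.integrable_diff integrable)
  interpret integrated_supermartingale M F X "\<Sum>t. \<integral>\<omega>. c t \<omega> \<partial>M"
  proof
    fix t
    have sub: "subalgebra (F t) (F s)" if "s \<le> t" for s
      using subalg[of s] subalg[of t] mono[of s t] that by (auto simp: subalgebra_def)
    have [measurable]: "V t \<in> borel_measurable (F t)" by (rule adapted)
    have [measurable]: "b s \<in> borel_measurable (F t)" "c s \<in> borel_measurable (F t)"
      if "s \<in> {..<t}" for s
      using that adapted(2,3)[of s] measurable_from_subalg[OF sub[of s]] by simp_all
    show "X t \<in> borel_measurable (F t)"
      unfolding X_def by measurable
    show "(\<integral>\<omega>. indicator A \<omega> * X (Suc t) \<omega> \<partial>M) \<le> (\<integral>\<omega>. indicator A \<omega> * X t \<omega> \<partial>M)"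
      if A: "A \<in> sets (F t)" for A
    proof -
      have [measurable]: "A \<in> sets M" using A subalg[of t] by (auto simp: subalgebra_def)
      have I: "integrable M (\<lambda>\<omega>. indicator A \<omega> * f \<omega>)" if "integrable M f" for f :: "'a \<Rightarrow> real"
        using that integrable_mult_indicator[of A M f] by simp
      have "(\<integral>\<omega>. indicator A \<omega> * X (Suc t) \<omega> \<partial>M)
          = (\<integral>\<omega>. indicator A \<omega> * V (Suc t) \<omega> + indicator A \<omega> * (X (Suc t) \<omega> - V (Suc t) \<omega>) \<partial>M)"
        by (simp add: algebra_simps)
      also have "\<dots> = (\<integral>\<omega>. indicator A \<omega> * V (Suc t) \<omega> \<partial>M)
          + (\<integral>\<omega>. indicator A \<omega> * (X (Suc t) \<omega> - V (Suc t) \<omega>) \<partial>M)"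
        by (intro Bochner_Integration.integral_add I Bochner_Integration.integrable_diff X_int integrable)
      also have "\<dots> \<le> (\<integral>\<omega>. indicator A \<omega> * (V t \<omega> - b t \<omega> + c t \<omega>) \<partial>M)
          + (\<integral>\<omega>. indicator A \<omega> * (X (Suc t) \<omega> - V (Suc t) \<omega>) \<partial>M)"
        using drift[OF A] by simp
      also have "\<dots> = (\<integral>\<omega>. indicator A \<omega> * (V t \<omega> - b t \<omega> + c t \<omega>)
          + indicator A \<omega> * (X (Suc t) \<omega> - V (Suc t) \<omega>) \<partial>M)"
        by (intro Bochner_Integration.integral_add[symmetric] I Bochner_Integration.integrable_add
            Bochner_Integration.integrable_diff X_int integrable)
      also have "\<dots> = (\<integral>\<omega>. indicator A \<omega> * X t \<omega> \<partial>M)"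
        by (rule Bochner_Integration.integral_cong) (simp_all add: X_def algebra_simps)
      finally show ?thesis .
    qed
    show "(\<integral>\<omega>. max 0 (- X t \<omega>) \<partial>M) \<le> (\<Sum>t. \<integral>\<omega>. c t \<omega> \<partial>M)"
    proof -
      have "(\<integral>\<omega>. max 0 (- X t \<omega>) \<partial>M) \<le> (\<integral>\<omega>. (\<Sum>s<t. c s \<omega>) \<partial>M)"
      proof (rule integral_mono)
        show "max 0 (- X t \<omega>) \<le> (\<Sum>s<t. c s \<omega>)" for \<omega>
          using nonneg(1)[of t \<omega>] sum_nonneg[of "{..<t}" "\<lambda>s. b s \<omega>"]
            sum_nonneg[of "{..<t}" "\<lambda>s. c s \<omega>"] nonneg(2,3)
          by (auto simp: X_def sum_subtractf)
      qed (use X_int integrable in auto)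
      also have "\<dots> = (\<Sum>s<t. \<integral>\<omega>. c s \<omega> \<partial>M)"
        using integrable by (simp add: Bochner_Integration.integral_sum)
      also have "\<dots> \<le> (\<Sum>t. \<integral>\<omega>. c t \<omega> \<partial>M)"
        using nonneg by (intro sum_le_suminf summable) auto
      finally show ?thesis .
    qed
  qed (use subalg mono X_int in auto)
  have "AE \<omega> in M. summable (\<lambda>t. c t \<omega>)"
    by (rule AE_summable_of_summable_integral) (simp_all add: integrable(3) nonneg(3) summable)
  with AE_convergent show ?thesis
  proof eventually_elim
    case (elim \<omega>)
    then have "convergent (\<lambda>t. X t \<omega> + (\<Sum>s<t. c s \<omega>))"
      by (intro convergent_add) (auto simp: summable_iff_convergent)
    then have conv: "convergent (\<lambda>t. V t \<omega> + (\<Sum>s<t. b s \<omega>))"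
      by (simp add: X_def sum_subtractf)
    then obtain R where R: "\<And>t. \<bar>V t \<omega> + (\<Sum>s<t. b s \<omega>)\<bar> \<le> R"
      using convergent_imp_Bseq[OF conv] by (auto simp: Bseq_def)
    have "(\<Sum>s<t. b s \<omega>) \<le> R" for t
      using R[of t] nonneg(1)[of t \<omega>] by simp
    then have "summable (\<lambda>t. b t \<omega>)"
      using nonneg by (intro summableI_nonneg_bounded) auto
    moreover from this have "convergent (\<lambda>t. (V t \<omega> + (\<Sum>s<t. b s \<omega>)) - (\<Sum>s<t. b s \<omega>))"
      by (intro convergent_diff conv) (simp add: summable_iff_convergent)
    ultimately show ?case by simp
  qed
qed

subsection \<open>Subgradients of convex functions\<close>

text \<open>A hyperplane separates the point \<open>(z, f z)\<close> from the strict epigraph. Its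
  normal has a negative last component, and rescaling that to -1 leaves a subgradient in the other
  components.\<close>

lemma convex_on_exists_subgradient:
  fixes f :: "'b::euclidean_space \<Rightarrow> real"
  assumes "convex_on UNIV f"
  shows "\<exists>h. subgradient f z h"
proof -
  define S where "S = {(y, r). f y < r}"
  have "convex S"
  proof (rule convexI)
    fix p q :: "'b \<times> real" and u v :: real
    assume *: "p \<in> S" "q \<in> S" "0 \<le> u" "0 \<le> v" "u + v = 1"
    obtain y r y' r' where pq: "p = (y, r)" "q = (y', r')" by fastforce
    have "f (u *\<^sub>R y + v *\<^sub>R y') \<le> u * f y + v * f y'"
      using assms * by (simp add: convex_on_def)
    also have "\<dots> < u * r + v * r'"
    proof (cases "u = 0")
      case False
      then have "u * f y < u * r" using * pq by (auto simp: S_def)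
      moreover have "v * f y' \<le> v * r'" using * pq by (auto simp: S_def intro!: mult_left_mono)
      ultimately show ?thesis by simp
    qed (use * pq in \<open>auto simp: S_def\<close>)
    finally show "u *\<^sub>R p + v *\<^sub>R q \<in> S" by (simp add: pq S_def)
  qed
  moreover have "S \<noteq> {}" using gt_ex[of "f z"] by (auto simp: S_def)
  moreover have "S \<inter> {(z, f z)} = {}" by (auto simp: S_def)
  ultimately obtain ab c where ab: "ab \<noteq> 0" "\<forall>p\<in>S. ab \<bullet> p \<le> c" "ab \<bullet> (z, f z) \<ge> c"
    using separating_hyperplane_sets[of S "{(z, f z)}"] by auto
  obtain a b where ab_eq: "ab = (a, b)" by fastforce
  have sep: "a \<bullet> y + b * r \<le> a \<bullet> z + b * f z" if "f y < r" for y r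
    using ab(2,3) that by (force simp: ab_eq S_def)
  have "b \<le> 0"
    using sep[of z "f z + 1"] by (simp add: algebra_simps)
  moreover have "b \<noteq> 0"
  proof
    assume "b = 0"
    \<comment> \<open>A vertical hyperplane would give
      \<open>a \<bullet> y \<le> a \<bullet> z\<close> for all \<open>y\<close>, as \<open>f\<close>
      is finite everywhere; \<open>y = z + a\<close> refutes this.\<close>
    have "a \<bullet> a \<le> 0"
      using sep[of "z + a" "f (z + a) + 1"] \<open>b = 0\<close> by (simp add: algebra_simps)
    then have "a = 0"
      by (simp add: inner_eq_zero_iff antisym_conv)
    with ab(1) \<open>b = 0\<close> show False by (simp add: ab_eq zero_prod_def)
  qed
  ultimately have b: "b < 0" by simp
  have "f y - f z \<ge> (- 1 / b) * (a \<bullet> (y - z))" for y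
  \<comment> \<open>The strict epigraph contains \<open>(y, f y + e)\<close> for positive
    \<open>e\<close> but not \<open>(y, f y)\<close>.\<close>
  proof (rule field_le_epsilon)
    fix e :: real assume "0 < e"
    with sep[of y "f y + e"] b show "(- 1 / b) * (a \<bullet> (y - z)) \<le> f y - f z + e"
      by (simp add: field_simps inner_diff_right)
  qed
  then have "subgradient f z ((- 1 / b) *\<^sub>R a)"
    unfolding subgradient_def by (simp only: inner_scaleR_left) blast
  then show ?thesis ..
qed

lemma convex_on_lipschitz:
  fixes f :: "'b::euclidean_space \<Rightarrow> real"
  assumes convex: "convex_on UNIV f" and bound: "\<And>z h. subgradient f z h \<Longrightarrow> norm h \<le> G"
  shows "\<bar>f y - f z\<bar> \<le> G * norm (y - z)"
proof -
  have *: "f z - f y \<le> G * norm (y - z)" for y z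
  proof -
    obtain h where h: "subgradient f z h"
      using convex_on_exists_subgradient[OF convex] by blast
    then have "f z - f y \<le> - (h \<bullet> (y - z))"
      by (simp add: subgradient_def algebra_simps)
    also have "\<dots> \<le> norm h * norm (y - z)"
      using Cauchy_Schwarz_ineq2[of h "y - z"] by linarith
    also have "\<dots> \<le> G * norm (y - z)"
      using bound[OF h] by (intro mult_right_mono) auto
    finally show ?thesis .
  qed
  show ?thesis using *[of z y] *[of y z] by (simp add: norm_minus_commute abs_le_iff)
qed

subsection \<open>Averaging and dispersion\<close>

lemma norm_diff_power2:
  "(norm (x - y :: 'b::real_inner))\<^sup>2 = (norm x)\<^sup>2 + (norm y)\<^sup>2 - 2 * (x \<bullet> y)"
  by (simp add: power2_norm_eq_inner inner_diff_left inner_diff_right inner_commute)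

text \<open>The square of a mean is the mean of the squares minus the variance, the variance being
  written over pairs of independent indices.\<close>

lemma norm_power2_weighted_sum:
  fixes u :: "'n::finite \<Rightarrow> 'b::real_inner" and p :: "'n \<Rightarrow> real"
  assumes "(\<Sum>j\<in>UNIV. p j) = 1"
  shows "(norm (\<Sum>j\<in>UNIV. p j *\<^sub>R u j))\<^sup>2
    = (\<Sum>j\<in>UNIV. p j * (norm (u j))\<^sup>2)
      - (\<Sum>j\<in>UNIV. \<Sum>k\<in>UNIV. p j * p k * (norm (u j - u k))\<^sup>2) / 2"
proof -
  have "(\<Sum>j\<in>UNIV. \<Sum>k\<in>UNIV. p j * p k * (norm (u j - u k))\<^sup>2)
    = (\<Sum>j\<in>UNIV. \<Sum>k\<in>UNIV. p k * (p j * (norm (u j))\<^sup>2))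
      + (\<Sum>j\<in>UNIV. \<Sum>k\<in>UNIV. p j * (p k * (norm (u k))\<^sup>2))
      - 2 * (\<Sum>j\<in>UNIV. \<Sum>k\<in>UNIV. p j * p k * (u j \<bullet> u k))"
    by (simp add: norm_diff_power2 sum.distrib sum_subtractf sum_distrib_left algebra_simps)
  also have "(\<Sum>j\<in>UNIV. \<Sum>k\<in>UNIV. p k * (p j * (norm (u j))\<^sup>2)) = (\<Sum>j\<in>UNIV. p j * (norm (u j))\<^sup>2)"
    by (simp add: sum_distrib_right[symmetric] assms)
  also have "(\<Sum>j\<in>UNIV. \<Sum>k\<in>UNIV. p j * (p k * (norm (u k))\<^sup>2)) = (\<Sum>j\<in>UNIV. p j * (norm (u j))\<^sup>2)"
    by (simp add: sum_distrib_left[symmetric] sum_distrib_right[symmetric] assms)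
  also have "(\<Sum>j\<in>UNIV. \<Sum>k\<in>UNIV. p j * p k * (u j \<bullet> u k)) = (norm (\<Sum>j\<in>UNIV. p j *\<^sub>R u j))\<^sup>2"
    by (simp add: power2_norm_eq_inner inner_sum_left inner_sum_right sum_distrib_left
        algebra_simps inner_commute)
  finally show ?thesis by (simp add: field_simps)
qed

lemma norm_power2_weighted_sum_le:
  fixes u :: "'n::finite \<Rightarrow> 'b::real_inner" and p :: "'n \<Rightarrow> real"
  assumes "(\<Sum>j\<in>UNIV. p j) = 1" "\<And>j. 0 \<le> p j"
  shows "(norm (\<Sum>j\<in>UNIV. p j *\<^sub>R u j))\<^sup>2 \<le> (\<Sum>j\<in>UNIV. p j * (norm (u j))\<^sup>2)"
  unfolding norm_power2_weighted_sum[OF assms(1)] using assms(2) by (simp add: sum_nonneg)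

text \<open>This equals \<open>2 * CARD('n)\<close> times the total squared distance to the mean.
  The pairwise form does not mention the mean, which the random averaging does not preserve.\<close>

definition dispersion :: "('n::finite \<Rightarrow> 'b::real_inner) \<Rightarrow> real" where
  "dispersion u = (\<Sum>i\<in>UNIV. \<Sum>j\<in>UNIV. (norm (u i - u j))\<^sup>2)"

lemma dispersion_nonneg [simp]: "0 \<le> dispersion u"
  by (simp add: dispersion_def sum_nonneg)

lemma norm_diff_power2_le_dispersion: "(norm (u i - u j))\<^sup>2 \<le> dispersion u"
proof -
  have "(norm (u i - u j))\<^sup>2 \<le> (\<Sum>j\<in>UNIV. (norm (u i - u j))\<^sup>2)"
    by (intro member_le_sum) auto
  also have "\<dots> \<le> dispersion u"
    unfolding dispersion_def by (intro member_le_sum sum_nonneg) auto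
  finally show ?thesis .
qed

lemma norm_diff_le_sqrt_dispersion: "norm (u i - u j) \<le> sqrt (dispersion u)"
  by (intro real_le_rsqrt norm_diff_power2_le_dispersion)

text \<open>Separates the two quantities that averaging affects for different reasons: strict
  convexity lowers the sum of squares, and the conditional column sums keep the expected square of
  the sum from falling.\<close>

lemma dispersion_eq:
  fixes u :: "'n::finite \<Rightarrow> 'b::real_inner"
  shows "dispersion u = 2 * real CARD('n) * (\<Sum>i\<in>UNIV. (norm (u i))\<^sup>2)
    - 2 * (norm (\<Sum>i\<in>UNIV. u i))\<^sup>2"
proof -
  have "(norm (\<Sum>i\<in>UNIV. u i))\<^sup>2 = (\<Sum>i\<in>UNIV. \<Sum>j\<in>UNIV. u i \<bullet> u j)"
    by (simp add: power2_norm_eq_inner inner_sum_left inner_sum_right inner_commute)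
  then show ?thesis
    by (simp add: dispersion_def norm_diff_power2 sum.distrib sum_subtractf
        sum_distrib_left[symmetric] algebra_simps)
qed

lemma dispersion_le_of_norm_le:
  fixes u :: "'n::finite \<Rightarrow> 'b::real_inner"
  assumes "\<And>i j. (norm (u i - u j))\<^sup>2 \<le> e"
  shows "dispersion u \<le> (real CARD('n))\<^sup>2 * e"
proof -
  have "dispersion u \<le> (\<Sum>i\<in>(UNIV::'n set). \<Sum>j\<in>(UNIV::'n set). e)"
    unfolding dispersion_def by (intro sum_mono assms)
  then show ?thesis by (simp add: power2_eq_square)
qed

text \<open>The parameter \<open>e\<close> stays free: a small value preserves a contraction factor
  below 1 and charges the error \<open>y\<close> with \<open>1 / e\<close>.\<close>

lemma power2_sum_le_weighted:
  fixes x y e :: real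
  assumes "0 < e"
  shows "(x + y)\<^sup>2 \<le> (1 + e) * x\<^sup>2 + (1 + 1 / e) * y\<^sup>2"
proof -
  have "0 \<le> (e * x - y)\<^sup>2 / e" using assms by simp
  also have "\<dots> = e * x\<^sup>2 + y\<^sup>2 / e - 2 * x * y"
    using assms by (simp add: field_simps power2_eq_square)
  finally show ?thesis by (simp add: power2_sum algebra_simps)
qed

lemma dispersion_perturb:
  fixes u v :: "'n::finite \<Rightarrow> 'b::real_inner"
  assumes "0 < e" and close: "\<And>i. norm (u i - v i) \<le> d"
  shows "dispersion u \<le> (1 + e) * dispersion v + (1 + 1 / e) * (real CARD('n))\<^sup>2 * (2 * d)\<^sup>2"
proof -
  have "(norm (u i - u j))\<^sup>2 \<le> (1 + e) * (norm (v i - v j))\<^sup>2 + (1 + 1 / e) * (2 * d)\<^sup>2" for i j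
  proof -
    have "norm (u i - u j) \<le> norm (v i - v j) + 2 * d"
      using close[of i] close[of j] norm_triangle_ineq[of "v i - v j" "(u i - v i) - (u j - v j)"]
        norm_triangle_ineq4[of "u i - v i" "u j - v j"] by (simp add: algebra_simps)
    then have "(norm (u i - u j))\<^sup>2 \<le> (norm (v i - v j) + 2 * d)\<^sup>2"
      by (intro power_mono) auto
    also have "\<dots> \<le> (1 + e) * (norm (v i - v j))\<^sup>2 + (1 + 1 / e) * (2 * d)\<^sup>2"
      by (rule power2_sum_le_weighted[OF assms(1)])
    finally show ?thesis .
  qed
  then have "dispersion u
      \<le> (\<Sum>i\<in>UNIV. \<Sum>j\<in>UNIV. (1 + e) * (norm (v i - v j))\<^sup>2 + (1 + 1 / e) * (2 * d)\<^sup>2)"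
    unfolding dispersion_def by (intro sum_mono)
  also have "\<dots> = (1 + e) * dispersion v + (1 + 1 / e) * (real CARD('n))\<^sup>2 * (2 * d)\<^sup>2"
    by (simp add: dispersion_def sum.distrib sum_distrib_left power2_eq_square algebra_simps)
  finally show ?thesis .
qed

text \<open>A walk from the root uses at most \<open>card E\<close> edges, hence at most N^2, each
  of length at most sqrt e. Two walks join any two nodes, so each squared distance is at most 4 N^4
  e, and there are N^2 pairs.\<close>

lemma dispersion_le_of_spanning_tree:
  fixes u :: "'n::finite \<Rightarrow> 'b::real_inner"
  assumes tree: "has_spanning_rooted_tree E"
    and edge: "\<And>i j. (j, i) \<in> E \<Longrightarrow> (norm (u i - u j))\<^sup>2 \<le> e" and "0 \<le> e"
  shows "dispersion u \<le> 4 * real CARD('n) ^ 6 * e"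
proof -
  define N where "N = real CARD('n)"
  have path: "norm (u i - u j) \<le> real m * sqrt e" if "(j, i) \<in> E ^^ m" for m i j
    using that
  proof (induction m arbitrary: i)
    case (Suc m)
    then obtain k where k: "(j, k) \<in> E ^^ m" "(k, i) \<in> E" by auto
    have "norm (u i - u j) \<le> norm (u i - u k) + norm (u k - u j)"
      using norm_triangle_ineq[of "u i - u k" "u k - u j"] by simp
    also have "norm (u i - u k) \<le> sqrt e"
      using edge[OF k(2)] by (rule real_le_rsqrt)
    also have "norm (u k - u j) \<le> real m * sqrt e"
      by (rule Suc.IH[OF k(1)])
    finally show ?case by (simp add: algebra_simps)
  qed simp
  obtain r where r: "\<And>v. v \<noteq> r \<Longrightarrow> (r, v) \<in> E\<^sup>+"
    using tree by (auto simp: has_spanning_rooted_tree_def)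
  have "card E \<le> CARD('n \<times> 'n)" by (intro card_mono) auto
  then have cardE: "real (card E) \<le> N\<^sup>2"
    unfolding N_def by (metis card_prod of_nat_mono of_nat_mult power2_eq_square)
  have root: "norm (u i - u r) \<le> N\<^sup>2 * sqrt e" for i
  proof (cases "i = r")
    case False
    obtain m where m: "m \<le> card E" "(r, i) \<in> E ^^ m"
      using r[OF False] by (auto simp: trancl_finite_eq_relpow)
    have "norm (u i - u r) \<le> real m * sqrt e" by (rule path[OF m(2)])
    also have "\<dots> \<le> N\<^sup>2 * sqrt e"
      using m(1) cardE \<open>0 \<le> e\<close> by (intro mult_right_mono) auto
    finally show ?thesis .
  qed (use \<open>0 \<le> e\<close> in simp)
  have "(norm (u i - u j))\<^sup>2 \<le> 4 * N ^ 4 * e" for i j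
  proof -
    have "norm (u i - u j) \<le> 2 * N\<^sup>2 * sqrt e"
      using root[of i] root[of j] norm_triangle_ineq4[of "u i - u r" "u j - u r"] by simp
    then have "(norm (u i - u j))\<^sup>2 \<le> (2 * N\<^sup>2 * sqrt e)\<^sup>2"
      by (intro power_mono) auto
    also have "\<dots> = 4 * N ^ 4 * e"
      using \<open>0 \<le> e\<close> by (simp add: power_mult_distrib power_mult[symmetric])
    finally show ?thesis .
  qed
  then have "dispersion u \<le> N\<^sup>2 * (4 * N ^ 4 * e)"
    unfolding N_def by (rule dispersion_le_of_norm_le)
  also have "\<dots> = 4 * (N ^ 2 * N ^ 4) * e" by simp
  also have "N ^ 2 * N ^ 4 = N ^ 6" by (simp flip: power_add)
  finally show ?thesis by (simp add: N_def)
qed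

text \<open>The Dirichlet form of the weights, which need not be symmetric.\<close>

definition edge_energy :: "('n::finite \<Rightarrow> 'n \<Rightarrow> real) \<Rightarrow> ('n \<Rightarrow> 'b::real_inner) \<Rightarrow> real" where
  "edge_energy p u = (\<Sum>i\<in>UNIV. \<Sum>j\<in>UNIV. p i j * (norm (u i - u j))\<^sup>2)"

lemma edge_energy_nonneg: "(\<And>i j. 0 \<le> p i j) \<Longrightarrow> 0 \<le> edge_energy p u"
  by (simp add: edge_energy_def sum_nonneg)

lemma edge_le_edge_energy:
  assumes "\<And>i j. 0 \<le> p i j"
  shows "p i j * (norm (u i - u j))\<^sup>2 \<le> edge_energy p u"
proof -
  have "p i j * (norm (u i - u j))\<^sup>2 \<le> (\<Sum>j\<in>UNIV. p i j * (norm (u i - u j))\<^sup>2)"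
    using assms by (intro member_le_sum[where f = "\<lambda>j. p i j * (norm (u i - u j))\<^sup>2"]) auto
  also have "\<dots> \<le> edge_energy p u"
    unfolding edge_energy_def using assms
    by (intro member_le_sum[where f = "\<lambda>i. \<Sum>j\<in>UNIV. p i j * (norm (u i - u j))\<^sup>2"]
        sum_nonneg) auto
  finally show ?thesis .
qed

text \<open>The weight \<open>p i i\<close> makes the strict convexity of the square visible: it bounds the
  variance of the averaging in row \<open>i\<close> from below by the energy of the edges into \<open>i\<close>.\<close>

lemma sum_norm_power2_averaging_le:
  fixes u :: "'n::finite \<Rightarrow> 'b::real_inner"
  assumes nonneg: "\<And>i j. 0 \<le> p i j" and row: "\<And>i. (\<Sum>j\<in>UNIV. p i j) = 1"
    and loop: "\<And>i. \<gamma> \<le> p i i"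
  shows "(\<Sum>i\<in>UNIV. (norm (\<Sum>j\<in>UNIV. p i j *\<^sub>R u j))\<^sup>2)
    \<le> (\<Sum>i\<in>UNIV. \<Sum>j\<in>UNIV. p i j * (norm (u j))\<^sup>2) - \<gamma> / 2 * edge_energy p u"
proof -
  have "(norm (\<Sum>j\<in>UNIV. p i j *\<^sub>R u j))\<^sup>2
      \<le> (\<Sum>j\<in>UNIV. p i j * (norm (u j))\<^sup>2) - \<gamma> / 2 * (\<Sum>j\<in>UNIV. p i j * (norm (u i - u j))\<^sup>2)" for i
  proof -
    have "\<gamma> * (\<Sum>j\<in>UNIV. p i j * (norm (u i - u j))\<^sup>2)
        \<le> p i i * (\<Sum>j\<in>UNIV. p i j * (norm (u i - u j))\<^sup>2)"
      using nonneg loop by (intro mult_right_mono sum_nonneg) auto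
    also have "\<dots> = (\<Sum>k\<in>UNIV. p i i * p i k * (norm (u i - u k))\<^sup>2)"
      by (simp add: sum_distrib_left mult.assoc)
    also have "\<dots> \<le> (\<Sum>j\<in>UNIV. \<Sum>k\<in>UNIV. p i j * p i k * (norm (u j - u k))\<^sup>2)"
      using nonneg by (intro member_le_sum[where f = "\<lambda>j. \<Sum>k\<in>UNIV. p i j * p i k * (norm (u j - u k))\<^sup>2"]
          sum_nonneg) auto
    finally show ?thesis
      unfolding norm_power2_weighted_sum[OF row] by simp
  qed
  then have "(\<Sum>i\<in>UNIV. (norm (\<Sum>j\<in>UNIV. p i j *\<^sub>R u j))\<^sup>2)
      \<le> (\<Sum>i\<in>UNIV. (\<Sum>j\<in>UNIV. p i j * (norm (u j))\<^sup>2)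
          - \<gamma> / 2 * (\<Sum>j\<in>UNIV. p i j * (norm (u i - u j))\<^sup>2))"
    by (intro sum_mono)
  also have "\<dots> = (\<Sum>i\<in>UNIV. \<Sum>j\<in>UNIV. p i j * (norm (u j))\<^sup>2) - \<gamma> / 2 * edge_energy p u"
    by (simp add: sum_subtractf edge_energy_def sum_distrib_left)
  finally show ?thesis .
qed

text \<open>The energy dissipated in a window controls the initial energy: a node moves by no more
  than the dissipated energy, so the state during the window is close to the initial one.\<close>

lemma initial_edge_energy_le_dissipation:
  fixes u :: "nat \<Rightarrow> 'n::finite \<Rightarrow> 'b::real_inner"
  assumes nonneg: "\<And>k i j. k < B \<Longrightarrow> 0 \<le> p k i j"
    and row: "\<And>k i. k < B \<Longrightarrow> (\<Sum>j\<in>UNIV. p k i j) = 1"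
    and step: "\<And>k i. k < B \<Longrightarrow> u (Suc k) i = (\<Sum>j\<in>UNIV. p k i j *\<^sub>R u k j)"
  shows "(\<Sum>k<B. edge_energy (p k) (u 0))
    \<le> real B * (real CARD('n))\<^sup>2 * (3 * (1 + 2 * real B)) * (\<Sum>k<B. edge_energy (p k) (u k))"
proof -
  define Q where "Q = (\<Sum>k<B. edge_energy (p k) (u k))"
  have Q_nonneg: "0 \<le> Q" unfolding Q_def by (intro sum_nonneg edge_energy_nonneg nonneg) auto
  have le_Q: "edge_energy (p k) (u k) \<le> Q" if "k < B" for k
    unfolding Q_def using that by (intro member_le_sum edge_energy_nonneg nonneg) auto
  \<comment> \<open>Row sums equal to 1 make the displacement a weighted mean of differences, so
    Jensen's inequality bounds its square by the energy.\<close>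
  have move1: "(norm (u (Suc k) i - u k i))\<^sup>2 \<le> edge_energy (p k) (u k)" if k: "k < B" for k i
  proof -
    have "u (Suc k) i - u k i = (\<Sum>j\<in>UNIV. p k i j *\<^sub>R (u k j - u k i))"
      using row[OF k, of i]
      by (simp add: step[OF k] scaleR_diff_right sum_subtractf scaleR_sum_left[symmetric])
    then have "(norm (u (Suc k) i - u k i))\<^sup>2 \<le> (\<Sum>j\<in>UNIV. p k i j * (norm (u k i - u k j))\<^sup>2)"
      using norm_power2_weighted_sum_le[of "p k i" "\<lambda>j. u k j - u k i"] row[OF k] nonneg[OF k]
      by (simp add: norm_minus_commute[of "u k i"])
    also have "\<dots> \<le> edge_energy (p k) (u k)"
      unfolding edge_energy_def using nonneg[OF k]
      by (intro member_le_sum[where f = "\<lambda>i. \<Sum>j\<in>UNIV. p k i j * (norm (u k i - u k j))\<^sup>2"] sum_nonneg)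
         auto
    finally show ?thesis .
  qed
  \<comment> \<open>Fewer than \<open>B\<close> displacements are added up; squaring their sum costs
    at most the factor \<open>B\<close>.\<close>
  have move: "(norm (u k i - u 0 i))\<^sup>2 \<le> real B * Q" if k: "k < B" for k i
  proof -
    have "u k i - u 0 i = (\<Sum>l<k. u (Suc l) i - u l i)"
      by (simp add: sum_lessThan_telescope[of "\<lambda>l. u l i"])
    then have "(norm (u k i - u 0 i))\<^sup>2 \<le> (\<Sum>l<k. norm (u (Suc l) i - u l i))\<^sup>2"
      by (simp add: norm_sum power_mono)
    also have "\<dots> \<le> (\<Sum>l<k. (norm (u (Suc l) i - u l i))\<^sup>2) * real k"
      using sum_squared_le_sum_of_squares[of "\<lambda>l. norm (u (Suc l) i - u l i)" "{..<k}"] by simp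
    also have "\<dots> \<le> Q * real B"
    proof (intro mult_mono)
      have "(\<Sum>l<k. (norm (u (Suc l) i - u l i))\<^sup>2) \<le> (\<Sum>l<k. edge_energy (p l) (u l))"
        using k by (intro sum_mono move1) auto
      also have "\<dots> \<le> Q"
        unfolding Q_def using k by (intro sum_mono2 edge_energy_nonneg nonneg) auto
      finally show "(\<Sum>l<k. (norm (u (Suc l) i - u l i))\<^sup>2) \<le> Q" .
    qed (use k Q_nonneg in auto)
    finally show ?thesis by (simp add: mult.commute)
  qed
  have "p k i j * (norm (u 0 i - u 0 j))\<^sup>2 \<le> 3 * (1 + 2 * real B) * Q" if k: "k < B" for k i j
  proof -
    \<comment> \<open>The detour through time \<open>k\<close> has three legs, whence the factor 3;
      the two legs in time cost \<open>B * Q\<close> each.\<close>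
    have "(norm (u 0 i - u 0 j))\<^sup>2 \<le> 3 * ((norm (u k i - u k j))\<^sup>2 + real B * Q + real B * Q)"
    proof -
      define a b c where "a = norm (u k i - u k j)" and "b = norm (u k i - u 0 i)"
        and "c = norm (u k j - u 0 j)"
      have "norm (u 0 i - u 0 j) \<le> a + b + c"
        using norm_triangle_ineq4[of "(u k i - u k j)" "(u k i - u 0 i) - (u k j - u 0 j)"]
          norm_triangle_ineq4[of "u k i - u 0 i" "u k j - u 0 j"]
        by (simp add: a_def b_def c_def algebra_simps)
      then have "(norm (u 0 i - u 0 j))\<^sup>2 \<le> (a + b + c)\<^sup>2"
        by (intro power_mono) auto
      also have "\<dots> \<le> 3 * (a\<^sup>2 + b\<^sup>2 + c\<^sup>2)"
        using sum_squares_bound[of a b] sum_squares_bound[of b c] sum_squares_bound[of a c]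
        by (simp add: power2_eq_square algebra_simps)
      also have "\<dots> \<le> 3 * (a\<^sup>2 + real B * Q + real B * Q)"
        unfolding b_def c_def by (intro mult_left_mono add_mono move[OF k]) auto
      finally show ?thesis by (simp add: a_def)
    qed
    then have "p k i j * (norm (u 0 i - u 0 j))\<^sup>2
        \<le> p k i j * (3 * ((norm (u k i - u k j))\<^sup>2 + real B * Q + real B * Q))"
      using nonneg[OF k] by (intro mult_left_mono)
    also have "\<dots> = 3 * (p k i j * (norm (u k i - u k j))\<^sup>2) + p k i j * (6 * real B * Q)"
      by (simp add: algebra_simps)
    \<comment> \<open>The weight has to stay on the first square, where the product is part of the
      energy; on the displacement terms \<open>p k i j \<le> 1\<close> suffices.\<close>
    also have "\<dots> \<le> 3 * Q + 1 * (6 * real B * Q)"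
    proof (intro add_mono mult_right_mono)
      show "3 * (p k i j * (norm (u k i - u k j))\<^sup>2) \<le> 3 * Q"
        using edge_le_edge_energy[of "p k" i j "u k"] nonneg[OF k] le_Q[OF k] by fastforce
      have "p k i j \<le> (\<Sum>j\<in>UNIV. p k i j)"
        using nonneg[OF k] by (intro member_le_sum) auto
      then show "p k i j \<le> 1" using row[OF k] by simp
    qed (use Q_nonneg in simp)
    also have "\<dots> = 3 * (1 + 2 * real B) * Q" by (simp add: algebra_simps)
    finally show ?thesis .
  qed
  then have "(\<Sum>k<B. edge_energy (p k) (u 0))
      \<le> (\<Sum>k<B. \<Sum>i\<in>(UNIV::'n set). \<Sum>j\<in>(UNIV::'n set). 3 * (1 + 2 * real B) * Q)"
    unfolding edge_energy_def by (intro sum_mono) auto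
  then show ?thesis by (simp add: Q_def power2_eq_square algebra_simps)
qed

text \<open>Summed over time, the recursion bounds each partial sum S by (1 - r) S \<le> a 0 +
  \<Sum>c.\<close>

lemma summable_of_contraction:
  fixes a c :: "nat \<Rightarrow> real"
  assumes nonneg: "\<And>k. 0 \<le> a k" "\<And>k. 0 \<le> c k" and "0 \<le> r" "r < 1"
    and step: "\<And>k. a (Suc k) \<le> r * a k + c k" and "summable c"
  shows "summable a"
proof (rule summableI_nonneg_bounded[OF nonneg(1)])
  fix n
  have "(\<Sum>k<n. a k) \<le> (\<Sum>k<Suc n. a k)" using nonneg(1) by simp
  also have "\<dots> = a 0 + (\<Sum>k<n. a (Suc k))" by (rule sum.lessThan_Suc_shift)
  also have "\<dots> \<le> a 0 + (\<Sum>k<n. r * a k + c k)" by (intro add_mono sum_mono step) simp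
  also have "\<dots> = a 0 + r * (\<Sum>k<n. a k) + (\<Sum>k<n. c k)"
    by (simp add: sum.distrib sum_distrib_left)
  also have "(\<Sum>k<n. c k) \<le> suminf c"
    using nonneg(2) \<open>summable c\<close> by (intro sum_le_suminf) auto
  finally have "(1 - r) * (\<Sum>k<n. a k) \<le> a 0 + suminf c" by (simp add: algebra_simps)
  then show "(\<Sum>k<n. a k) \<le> (a 0 + suminf c) / (1 - r)"
    using \<open>r < 1\<close> by (simp add: pos_le_divide_eq mult.commute)
qed

subsection \<open>Convergence along a sample path\<close>

text \<open>If \<open>h\<close> stayed above \<open>e\<close>, the weights would be dominated by the
  summable \<open>a t * h t / e\<close>.\<close>

lemma frequently_small_of_summable:
  fixes a h :: "nat \<Rightarrow> real"
  assumes a: "\<And>t. 0 \<le> a t" and div: "\<not> summable a" and sum: "summable (\<lambda>t. a t * h t)"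
    and "0 < e"
  shows "\<exists>\<^sub>F t in sequentially. h t < e"
proof (rule ccontr)
  assume "\<not> ?thesis"
  then have "\<forall>\<^sub>F t in sequentially. norm (a t) \<le> a t * h t / e"
    unfolding not_frequently
  proof eventually_elim
    case (elim t)
    then have "a t * e \<le> a t * h t" using a by (intro mult_left_mono) auto
    then show ?case using a[of t] \<open>0 < e\<close> by (simp add: field_simps)
  qed
  then have "summable a"
    by (rule summable_comparison_test_ev) (intro summable_divide sum)
  with div show False ..
qed

lemma frequently_small_imp_subseq:
  fixes h :: "nat \<Rightarrow> real"
  assumes nonneg: "\<And>t. 0 \<le> h t" and small: "\<And>e. 0 < e \<Longrightarrow> \<exists>\<^sub>F t in sequentially. h t < e"
  shows "\<exists>r. strict_mono r \<and> (h \<circ> r) \<longlonglongrightarrow> 0"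
proof -
  have "\<exists>r. \<forall>n. h (r n) < inverse (real (Suc n)) \<and> r n < r (Suc n)"
  proof (rule dependent_nat_choice)
    show "\<exists>t. h t < inverse (real (Suc 0))"
      using small[of 1] frequently_ex by fastforce
    show "\<exists>t. h t < inverse (real (Suc (Suc n))) \<and> s < t" for s n
      using small[of "inverse (real (Suc (Suc n)))"]
      by (auto simp: frequently_sequentially dest!: spec[of _ "Suc s"] intro: Suc_le_lessD)
  qed
  then obtain r where r: "\<And>n. h (r n) < inverse (real (Suc n))" "\<And>n. r n < r (Suc n)"
    by blast
  have "(h \<circ> r) \<longlonglongrightarrow> 0"
    by (rule tendsto_sandwich[OF _ _ tendsto_const LIMSEQ_inverse_real_of_nat])
       (use nonneg less_imp_le[OF r(1)] in auto)
  with r(2) show ?thesis by (auto intro: strict_monoI_Suc)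
qed

text \<open>Summability against divergent weights only brings the value of node \<open>i0\<close>
  near the minimum infinitely often. Compactness extracts from these times a limit point
  \<open>z\<close>, which is a minimizer, and the vanishing dispersion attaches all nodes to it.
  Convergence of the distances then promotes the subsequence to the whole sequence.\<close>

lemma consensus_at_minimizer:
  fixes x :: "nat \<Rightarrow> 'n::finite \<Rightarrow> 'b::euclidean_space" and \<Phi> :: "'b \<Rightarrow> real" and i0 :: 'n
  assumes cont: "continuous_on UNIV \<Phi>" and minimal: "\<And>y. \<Phi>0 \<le> \<Phi> y"
    and dense: "D \<subseteq> {z. \<Phi> z = \<Phi>0}" "{z. \<Phi> z = \<Phi>0} \<subseteq> closure D" "D \<noteq> {}"
    and fejer: "\<And>z. z \<in> D \<Longrightarrow> convergent (\<lambda>t. \<Sum>i\<in>UNIV. (norm (x t i - z))\<^sup>2)"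
    and disp: "(\<lambda>t. dispersion (x t)) \<longlonglongrightarrow> 0"
    and weight: "\<And>t. 0 \<le> a t" "\<not> summable a"
    and sum: "summable (\<lambda>t. a t * (\<Phi> (x t i0) - \<Phi>0))"
  shows "\<exists>z. \<Phi> z = \<Phi>0 \<and> (\<forall>i. (\<lambda>t. x t i) \<longlonglongrightarrow> z)"
proof -
  define V where "V z t = (\<Sum>i\<in>UNIV. (norm (x t i - z))\<^sup>2)" for z t
  have V: "norm (x t i - z) \<le> sqrt (V z t)" for t i z
    unfolding V_def by (intro real_le_rsqrt member_le_sum) auto
  obtain z0 where z0: "z0 \<in> D" using dense(3) by blast
  obtain R where "\<And>t. norm (V z0 t) \<le> R"
    using convergent_imp_Bseq[OF fejer[OF z0]] by (auto simp: Bseq_def V_def)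
  then have R: "sqrt (V z0 t) \<le> sqrt R" for t
    by (intro real_sqrt_le_mono) (auto intro: order_trans[OF abs_ge_self])
  have "norm (x t i0) \<le> norm z0 + sqrt R" for t
    using V[of t i0 z0] norm_triangle_ineq[of z0 "x t i0 - z0"] R[of t] by (simp del: real_sqrt_le_iff)
  then have "bounded (range (\<lambda>t. x t i0))"
    by (intro boundedI) auto
  obtain r where r: "strict_mono r" "((\<lambda>t. \<Phi> (x t i0) - \<Phi>0) \<circ> r) \<longlonglongrightarrow> 0"
    using frequently_small_imp_subseq[of "\<lambda>t. \<Phi> (x t i0) - \<Phi>0"] minimal
      frequently_small_of_summable[OF weight sum] by auto
  have "bounded (range (\<lambda>n. x (r n) i0))"
    by (rule bounded_subset[OF \<open>bounded (range (\<lambda>t. x t i0))\<close>]) auto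
  then obtain z s where s: "strict_mono s" "((\<lambda>n. x (r n) i0) \<circ> s) \<longlonglongrightarrow> z"
    using bounded_imp_convergent_subsequence by blast
  define k where "k n = r (s n)" for n
  have k: "strict_mono k"
    using strict_mono_o[OF r(1) s(1)] by (simp add: k_def[abs_def] comp_def)
  have lim0: "(\<lambda>n. x (k n) i0) \<longlonglongrightarrow> z"
    using s(2) by (simp add: comp_def k_def)
  have "(\<lambda>n. \<Phi> (x (k n) i0) - \<Phi>0) \<longlonglongrightarrow> 0"
    using LIMSEQ_subseq_LIMSEQ[OF r(2) s(1)] by (simp add: comp_def k_def)
  moreover have "(\<lambda>n. \<Phi> (x (k n) i0) - \<Phi>0) \<longlonglongrightarrow> \<Phi> z - \<Phi>0"
    using cont lim0 by (intro tendsto_diff tendsto_const)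
      (auto simp: continuous_on_eq_continuous_at intro: isCont_tendsto_compose)
  ultimately have "\<Phi> z - \<Phi>0 = 0" using LIMSEQ_unique by blast
  then have z: "\<Phi> z = \<Phi>0" by simp
  have lim: "(\<lambda>n. x (k n) i) \<longlonglongrightarrow> z" for i
  proof -
    have "(\<lambda>n. sqrt (dispersion (x (k n)))) \<longlonglongrightarrow> sqrt 0"
      using LIMSEQ_subseq_LIMSEQ[OF disp k] by (intro tendsto_real_sqrt) (simp add: comp_def)
    then have sqrt_lim: "(\<lambda>n. sqrt (dispersion (x (k n)))) \<longlonglongrightarrow> 0" by simp
    have "(\<lambda>n. x (k n) i - x (k n) i0) \<longlonglongrightarrow> 0"
      by (rule Lim_null_comparison[OF _ sqrt_lim]) (simp add: norm_diff_le_sqrt_dispersion)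
    from tendsto_add[OF this lim0] show ?thesis by simp
  qed
  have "(\<lambda>t. x t i) \<longlonglongrightarrow> z" for i
  proof (rule LIMSEQ_I)
    fix e :: real assume "0 < e"
    define N where "N = real CARD('n)"
    have N: "1 \<le> N" unfolding N_def using zero_less_card_finite[where 'a = 'n] by linarith
    \<comment> \<open>A sum of squares below \<open>N * d\<^sup>2\<close> puts every node within
      \<open>e / 2\<close> of \<open>y\<close>, and \<open>d \<le> e / 2\<close> covers the way from
      \<open>y\<close> to \<open>z\<close>.\<close>
    define d where "d = e / (2 * sqrt N)"
    have d: "0 < d" using \<open>0 < e\<close> N by (simp add: d_def)
    \<comment> \<open>The distances are known to converge for points of \<open>D\<close> only, and
      \<open>z\<close> may lie outside \<open>D\<close>.\<close>
    obtain y where y: "y \<in> D" "dist y z < d"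
      using dense(2) z d by (auto simp: closure_approachable subset_iff)
    obtain l where l: "V y \<longlonglongrightarrow> l" using fejer[OF y(1)] by (auto simp: convergent_def V_def[abs_def])
    \<comment> \<open>As \<open>V y\<close> converges along all times, its limit can be read off
      along the subsequence.\<close>
    have "(\<lambda>n. V y (k n)) \<longlonglongrightarrow> (\<Sum>i\<in>(UNIV::'n set). (norm (z - y))\<^sup>2)"
      unfolding V_def by (intro tendsto_intros lim)
    then have "l = (\<Sum>i\<in>(UNIV::'n set). (norm (z - y))\<^sup>2)"
      using LIMSEQ_subseq_LIMSEQ[OF l k] LIMSEQ_unique by (auto simp: comp_def)
    also have "\<dots> < N * d\<^sup>2"
      using y(2) N by (simp add: N_def[symmetric] dist_norm norm_minus_commute power_strict_mono)
    finally have "\<forall>\<^sub>F t in sequentially. V y t < N * d\<^sup>2"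
      using order_tendstoD(2)[OF l] by blast
    then obtain t0 where t0: "\<And>t. t \<ge> t0 \<Longrightarrow> V y t < N * d\<^sup>2"
      by (auto simp: eventually_sequentially)
    have "norm (x t i - z) < e" if "t \<ge> t0" for t
    proof -
      have "norm (x t i - y) < sqrt (N * d\<^sup>2)"
        using V[of t i y] real_sqrt_less_mono[OF t0[OF that]] by linarith
      also have "\<dots> = e / 2"
        using N d \<open>0 < e\<close> by (simp add: real_sqrt_mult) (simp add: d_def)
      finally have "norm (x t i - y) < e / 2" .
      moreover have "d \<le> e / 2"
        using N \<open>0 < e\<close> by (simp add: d_def field_simps)
      ultimately show ?thesis
        using y(2) norm_triangle_ineq[of "x t i - y" "y - z"] by (simp add: dist_norm)
    qed
    then show "\<exists>t0. \<forall>t\<ge>t0. norm (x t i - z) < e" by blast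
  qed
  with z show ?thesis by blast
qed

subsection \<open>Essentially bounded random variables\<close>

text \<open>A class closed under the operations of the iteration in which integrability is
  automatic. Membership also records what is known at a given time, through measurability in
  \<open>F\<close>; the bound is only almost sure, because the properties of the weights
  are.\<close>

definition ess_bounded :: "'a measure \<Rightarrow> 'a measure \<Rightarrow> ('a \<Rightarrow> 'b::euclidean_space) set" where
  "ess_bounded M F = {h \<in> borel_measurable F. \<exists>C. AE \<omega> in M. norm (h \<omega>) \<le> C}"

lemma ess_boundedI:
  "h \<in> borel_measurable F \<Longrightarrow> AE \<omega> in M. norm (h \<omega>) \<le> C \<Longrightarrow> h \<in> ess_bounded M F"
  by (auto simp: ess_bounded_def)

lemma ess_boundedE:
  assumes "h \<in> ess_bounded M F"
  obtains C where "h \<in> borel_measurable F" "AE \<omega> in M. norm (h \<omega>) \<le> C" "0 \<le> C"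
proof -
  obtain C where *: "h \<in> borel_measurable F" "AE \<omega> in M. norm (h \<omega>) \<le> C"
    using assms by (auto simp: ess_bounded_def)
  from *(2) have "AE \<omega> in M. norm (h \<omega>) \<le> max 0 C" by eventually_elim simp
  with *(1) show ?thesis by (intro that) auto
qed

lemma ess_bounded_measurable: "h \<in> ess_bounded M F \<Longrightarrow> h \<in> borel_measurable F"
  by (simp add: ess_bounded_def)

lemma ess_bounded_const: "(\<lambda>\<omega>. c) \<in> ess_bounded M F"
  by (rule ess_boundedI[where C = "norm c"]) auto

lemma ess_bounded_indicator: "A \<in> sets F \<Longrightarrow> (indicator A :: _ \<Rightarrow> real) \<in> ess_bounded M F"
  by (rule ess_boundedI[where C = 1]) (auto simp: indicator_def)

lemma ess_bounded_norm_power2: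
  assumes "h \<in> ess_bounded M F"
  shows "(\<lambda>\<omega>. (norm (h \<omega>))\<^sup>2) \<in> ess_bounded M F"
proof -
  obtain C where [measurable]: "h \<in> borel_measurable F" and C: "AE \<omega> in M. norm (h \<omega>) \<le> C" "0 \<le> C"
    using assms by (rule ess_boundedE)
  from C(1) have "AE \<omega> in M. norm ((norm (h \<omega>))\<^sup>2) \<le> C\<^sup>2"
    by eventually_elim (auto intro: power_mono)
  then show ?thesis by (intro ess_boundedI) measurable
qed

lemma ess_bounded_add:
  assumes "h \<in> ess_bounded M F" "k \<in> ess_bounded M F"
  shows "(\<lambda>\<omega>. h \<omega> + k \<omega>) \<in> ess_bounded M F"
proof -
  obtain C where [measurable]: "h \<in> borel_measurable F" and C: "AE \<omega> in M. norm (h \<omega>) \<le> C" "0 \<le> C"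
    using assms(1) by (rule ess_boundedE)
  obtain D where [measurable]: "k \<in> borel_measurable F" and D: "AE \<omega> in M. norm (k \<omega>) \<le> D" "0 \<le> D"
    using assms(2) by (rule ess_boundedE)
  from C(1) D(1) have "AE \<omega> in M. norm (h \<omega> + k \<omega>) \<le> C + D"
    by eventually_elim (rule norm_triangle_mono)
  then show ?thesis by (intro ess_boundedI) measurable
qed

lemma ess_bounded_scaleR:
  assumes "h \<in> ess_bounded M F" "k \<in> ess_bounded M F"
  shows "(\<lambda>\<omega>. h \<omega> *\<^sub>R k \<omega>) \<in> ess_bounded M F"
proof -
  obtain C where [measurable]: "h \<in> borel_measurable F" and C: "AE \<omega> in M. norm (h \<omega>) \<le> C" "0 \<le> C"
    using assms(1) by (rule ess_boundedE)
  obtain D where [measurable]: "k \<in> borel_measurable F" and D: "AE \<omega> in M. norm (k \<omega>) \<le> D" "0 \<le> D"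
    using assms(2) by (rule ess_boundedE)
  from C(1) D(1) have "AE \<omega> in M. norm (h \<omega> *\<^sub>R k \<omega>) \<le> C * D"
    by eventually_elim (use C(2) in \<open>auto intro!: mult_mono\<close>)
  then show ?thesis by (intro ess_boundedI) measurable
qed

lemma ess_bounded_mult:
  fixes h k :: "'a \<Rightarrow> real"
  shows "h \<in> ess_bounded M F \<Longrightarrow> k \<in> ess_bounded M F \<Longrightarrow> (\<lambda>\<omega>. h \<omega> * k \<omega>) \<in> ess_bounded M F"
  using ess_bounded_scaleR[of h M F k] by simp

lemma ess_bounded_inner:
  assumes "h \<in> ess_bounded M F" "k \<in> ess_bounded M F"
  shows "(\<lambda>\<omega>. h \<omega> \<bullet> k \<omega>) \<in> ess_bounded M F"
proof -
  obtain C where [measurable]: "h \<in> borel_measurable F" and C: "AE \<omega> in M. norm (h \<omega>) \<le> C" "0 \<le> C"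
    using assms(1) by (rule ess_boundedE)
  obtain D where [measurable]: "k \<in> borel_measurable F" and D: "AE \<omega> in M. norm (k \<omega>) \<le> D" "0 \<le> D"
    using assms(2) by (rule ess_boundedE)
  from C(1) D(1) have "AE \<omega> in M. norm (h \<omega> \<bullet> k \<omega>) \<le> C * D"
  proof eventually_elim
    case (elim \<omega>)
    then have "norm (h \<omega>) * norm (k \<omega>) \<le> C * D" using C(2) by (intro mult_mono) auto
    with Cauchy_Schwarz_ineq2[of "h \<omega>" "k \<omega>"] show ?case by simp
  qed
  then show ?thesis by (intro ess_boundedI) measurable
qed

lemma ess_bounded_diff:
  "h \<in> ess_bounded M F \<Longrightarrow> k \<in> ess_bounded M F \<Longrightarrow> (\<lambda>\<omega>. h \<omega> - k \<omega>) \<in> ess_bounded M F"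
  using ess_bounded_add[of h M F "\<lambda>\<omega>. (-1) *\<^sub>R k \<omega>"]
    ess_bounded_scaleR[OF ess_bounded_const[of "-1 :: real"], of k M F] by simp

lemma ess_bounded_sum:
  "(\<And>i. i \<in> I \<Longrightarrow> h i \<in> ess_bounded M F) \<Longrightarrow> (\<lambda>\<omega>. \<Sum>i\<in>I. h i \<omega>) \<in> ess_bounded M F"
  by (induction I rule: infinite_finite_induct) (simp_all add: ess_bounded_const ess_bounded_add)

lemmas ess_bounded_intros = ess_bounded_const ess_bounded_norm_power2 ess_bounded_sum
  ess_bounded_diff ess_bounded_add ess_bounded_mult ess_bounded_scaleR ess_bounded_inner

lemma ess_bounded_dispersion:
  "(\<And>i. u i \<in> ess_bounded M F) \<Longrightarrow> (\<lambda>\<omega>. dispersion (\<lambda>i. u i \<omega>)) \<in> ess_bounded M F"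
  unfolding dispersion_def by (intro ess_bounded_intros)

lemma ess_bounded_edge_energy:
  "(\<And>i j. p i j \<in> ess_bounded M F) \<Longrightarrow> (\<And>i. u i \<in> ess_bounded M F)
    \<Longrightarrow> (\<lambda>\<omega>. edge_energy (\<lambda>i j. p i j \<omega>) (\<lambda>i. u i \<omega>)) \<in> ess_bounded M F"
  unfolding edge_energy_def by (intro ess_bounded_intros)

lemma ess_bounded_mono:
  "subalgebra G F \<Longrightarrow> h \<in> ess_bounded M F \<Longrightarrow> h \<in> ess_bounded M G"
  by (auto simp: ess_bounded_def intro: measurable_from_subalg)

lemma (in prob_space) ess_bounded_integrable:
  assumes "subalgebra M F" "h \<in> ess_bounded M F"
  shows "integrable M h"
proof -
  obtain C where "h \<in> borel_measurable F" "AE \<omega> in M. norm (h \<omega>) \<le> C"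
    using assms(2) by (rule ess_boundedE)
  then show ?thesis
    using measurable_from_subalg[OF assms(1)] by (intro integrable_const_bound) auto
qed

subsection \<open>Contraction of the expected dispersion under random averaging\<close>

text \<open>Rows are stochastic for almost every realization, columns only in conditional
  expectation given the previous time. A realized averaging step may therefore move the mean of the
  nodes.\<close>

locale random_averaging = prob_space M for M :: "'a measure" +
  fixes F :: "nat \<Rightarrow> 'a measure" and w :: "nat \<Rightarrow> 'n::finite \<Rightarrow> 'n \<Rightarrow> 'a \<Rightarrow> real"
    and \<gamma> :: real and t0 :: nat
  assumes subalg: "\<And>t. subalgebra M (F t)"
    and F_mono: "\<And>s t. s \<le> t \<Longrightarrow> subalgebra (F t) (F s)"
    and w_measurable: "\<And>t i j. w t i j \<in> borel_measurable (F t)"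
    and w_nonneg: "\<And>t. t0 \<le> t \<Longrightarrow> AE \<omega> in M. \<forall>i j. 0 \<le> w t i j \<omega>"
    and w_row: "\<And>t. t0 \<le> t \<Longrightarrow> AE \<omega> in M. \<forall>i. (\<Sum>j\<in>UNIV. w t i j \<omega>) = 1"
    and w_loop: "\<And>t. t0 \<le> t \<Longrightarrow> AE \<omega> in M. \<forall>i. \<gamma> \<le> w t i i \<omega>"
    and w_column: "\<And>t. t0 \<le> t \<Longrightarrow>
      AE \<omega> in M. \<forall>j. (\<Sum>i\<in>UNIV. real_cond_exp M (F t) (w (Suc t) i j) \<omega>) = 1"
    and gamma: "0 < \<gamma>" "\<gamma> < 1"
begin

definition avg :: "nat \<Rightarrow> ('n \<Rightarrow> 'a \<Rightarrow> 'b::euclidean_space) \<Rightarrow> 'n \<Rightarrow> 'a \<Rightarrow> 'b" where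
  "avg t u i \<omega> = (\<Sum>j\<in>UNIV. w t i j \<omega> *\<^sub>R u j \<omega>)"

text \<open>The pull-out property under the integral: against a factor known at time
  \<open>s\<close>, a weight and its conditional expectation are interchangeable.\<close>

lemma cond_exp_mult:
  assumes h: "h \<in> ess_bounded M (F s)" and "integrable M (\<lambda>\<omega>. h \<omega> * w t i j \<omega>)"
  shows "integrable M (\<lambda>\<omega>. h \<omega> * real_cond_exp M (F s) (w t i j) \<omega>)"
    and "(\<integral>\<omega>. h \<omega> * real_cond_exp M (F s) (w t i j) \<omega> \<partial>M) = (\<integral>\<omega>. h \<omega> * w t i j \<omega> \<partial>M)"
proof -
  have w: "w t i j \<in> borel_measurable M"
    using subalg w_measurable by (rule measurable_from_subalg)
  interpret finite_measure_subalgebra M "F s"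
    by unfold_locales (rule subalg)
  show "integrable M (\<lambda>\<omega>. h \<omega> * real_cond_exp M (F s) (w t i j) \<omega>)"
    "(\<integral>\<omega>. h \<omega> * real_cond_exp M (F s) (w t i j) \<omega> \<partial>M) = (\<integral>\<omega>. h \<omega> * w t i j \<omega> \<partial>M)"
    using assms(2) ess_bounded_measurable[OF h] w by (auto intro: real_cond_exp_intg)
qed

lemma w_ess_bounded:
  assumes "t0 \<le> t"
  shows "w t i j \<in> ess_bounded M (F t)"
proof (rule ess_boundedI[OF w_measurable])
  show "AE \<omega> in M. norm (w t i j \<omega>) \<le> 1"
    using w_nonneg[OF assms] w_row[OF assms]
  proof eventually_elim
    case (elim \<omega>)
    then have "w t i j \<omega> \<le> (\<Sum>j\<in>UNIV. w t i j \<omega>)"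
      by (intro member_le_sum[where f = "\<lambda>j. w t i j \<omega>"]) auto
    with elim show ?case by simp
  qed
qed

lemma integrableI: "h \<in> ess_bounded M (F t) \<Longrightarrow> integrable M h"
  by (rule ess_bounded_integrable[OF subalg])

lemma ess_bounded_F_mono: "s \<le> t \<Longrightarrow> h \<in> ess_bounded M (F s) \<Longrightarrow> h \<in> ess_bounded M (F t)"
  by (rule ess_bounded_mono[OF F_mono])

lemma avg_ess_bounded:
  assumes "t0 \<le> t" "\<And>i. u i \<in> ess_bounded M (F s)" "s \<le> t"
  shows "avg t u i \<in> ess_bounded M (F t)"
  unfolding avg_def[abs_def] using assms
  by (intro ess_bounded_sum ess_bounded_scaleR w_ess_bounded) (auto intro: ess_bounded_F_mono)

text \<open>The \<open>h j\<close> are known at time \<open>t\<close>, so the next weights may be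
  replaced by their conditional expectations, and those have column sums 1.\<close>

lemma expectation_column:
  assumes "t0 \<le> t" and h: "\<And>j. h j \<in> ess_bounded M (F t)"
  shows "(\<integral>\<omega>. (\<Sum>i\<in>UNIV. \<Sum>j\<in>UNIV. w (Suc t) i j \<omega> * h j \<omega>) \<partial>M) = (\<integral>\<omega>. (\<Sum>j\<in>UNIV. h j \<omega>) \<partial>M)"
proof -
  have int: "integrable M (\<lambda>\<omega>. h j \<omega> * w (Suc t) i j \<omega>)" for i j
    using h ess_bounded_F_mono[of t "Suc t"] w_ess_bounded[of "Suc t"] assms(1)
    by (intro integrableI[of _ "Suc t"] ess_bounded_mult) auto
  have "(\<integral>\<omega>. (\<Sum>i\<in>UNIV. \<Sum>j\<in>UNIV. w (Suc t) i j \<omega> * h j \<omega>) \<partial>M)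
      = (\<integral>\<omega>. (\<Sum>j\<in>UNIV. \<Sum>i\<in>UNIV. h j \<omega> * w (Suc t) i j \<omega>) \<partial>M)"
    by (subst sum.swap) (simp add: mult.commute)
  also have "\<dots> = (\<Sum>j\<in>UNIV. \<Sum>i\<in>UNIV. \<integral>\<omega>. h j \<omega> * w (Suc t) i j \<omega> \<partial>M)"
    using int by (simp add: Bochner_Integration.integral_sum)
  also have "\<dots> = (\<Sum>j\<in>UNIV. \<integral>\<omega>. h j \<omega> \<partial>M)"
  proof (intro sum.cong refl)
    fix j
    have "(\<Sum>i\<in>UNIV. \<integral>\<omega>. h j \<omega> * w (Suc t) i j \<omega> \<partial>M)
        = (\<Sum>i\<in>UNIV. \<integral>\<omega>. h j \<omega> * real_cond_exp M (F t) (w (Suc t) i j) \<omega> \<partial>M)"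
      using cond_exp_mult(2)[OF h int] by simp
    also have "\<dots> = (\<integral>\<omega>. (\<Sum>i\<in>UNIV. h j \<omega> * real_cond_exp M (F t) (w (Suc t) i j) \<omega>) \<partial>M)"
      using cond_exp_mult(1)[OF h int] by (simp add: Bochner_Integration.integral_sum)
    also have "\<dots> = (\<integral>\<omega>. h j \<omega> \<partial>M)"
    proof (rule integral_cong_AE)
      show "(\<lambda>\<omega>. \<Sum>i\<in>UNIV. h j \<omega> * real_cond_exp M (F t) (w (Suc t) i j) \<omega>) \<in> borel_measurable M"
        using cond_exp_mult(1)[OF h int] by (intro borel_measurable_sum) auto
      show "h j \<in> borel_measurable M" using integrableI[OF h] by auto
      show "AE \<omega> in M. (\<Sum>i\<in>UNIV. h j \<omega> * real_cond_exp M (F t) (w (Suc t) i j) \<omega>) = h j \<omega>"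
        using w_column[OF assms(1)] by eventually_elim (simp flip: sum_distrib_left)
    qed
    finally show "(\<Sum>i\<in>UNIV. \<integral>\<omega>. h j \<omega> * w (Suc t) i j \<omega> \<partial>M) = (\<integral>\<omega>. h j \<omega> \<partial>M)" .
  qed
  also have "\<dots> = (\<integral>\<omega>. (\<Sum>j\<in>UNIV. h j \<omega>) \<partial>M)"
    using integrableI[OF h] by (simp add: Bochner_Integration.integral_sum)
  finally show ?thesis .
qed

definition exp_dispersion :: "('n \<Rightarrow> 'a \<Rightarrow> 'b::euclidean_space) \<Rightarrow> real" where
  "exp_dispersion u = (\<integral>\<omega>. dispersion (\<lambda>i. u i \<omega>) \<partial>M)"

definition dissipation :: "nat \<Rightarrow> ('n \<Rightarrow> 'a \<Rightarrow> 'b::euclidean_space) \<Rightarrow> real" where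
  "dissipation t u = (\<integral>\<omega>. edge_energy (\<lambda>i j. w t i j \<omega>) (\<lambda>i. u i \<omega>) \<partial>M)"

lemma exp_dispersion_nonneg [simp]: "0 \<le> exp_dispersion u"
  by (simp add: exp_dispersion_def)

lemma dissipation_nonneg: "t0 \<le> t \<Longrightarrow> 0 \<le> dissipation t u"
  unfolding dissipation_def using w_nonneg[of t]
  by (intro integral_nonneg_AE) (auto intro: edge_energy_nonneg elim!: eventually_mono)

text \<open>Of the two parts in \<open>dispersion_eq\<close>, the sum of squares loses
  \<open>\<gamma> / 2\<close> times the dissipation by strict convexity, and its prefactor
  \<open>2 * N\<close> turns this into \<open>N * \<gamma>\<close>. The square of the total cannot
  decrease in expectation: given the past, the new total has mean \<open>s\<close>, so this is
  Jensen's inequality.\<close>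

lemma exp_dispersion_avg_le:
  fixes u :: "'n \<Rightarrow> 'a \<Rightarrow> 'b::euclidean_space"
  assumes t: "t0 \<le> t" and u: "\<And>i. u i \<in> ess_bounded M (F t)"
  shows "exp_dispersion (avg (Suc t) u) \<le> exp_dispersion u - real CARD('n) * \<gamma> * dissipation (Suc t) u"
proof -
  define N where "N = real CARD('n)"
  define y where "y = avg (Suc t) u"
  define s where "s \<omega> = (\<Sum>j\<in>UNIV. u j \<omega>)" for \<omega>
  have t': "t0 \<le> Suc t" using t by simp
  have u': "u i \<in> ess_bounded M (F (Suc t))" for i
    using u by (rule ess_bounded_F_mono[rotated]) simp
  have y: "y i \<in> ess_bounded M (F (Suc t))" for i
    unfolding y_def using t' u' by (rule avg_ess_bounded) simp
  have s: "s \<in> ess_bounded M (F t)"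
    unfolding s_def[abs_def] by (intro ess_bounded_intros u)
  have s': "s \<in> ess_bounded M (F (Suc t))"
    using s by (rule ess_bounded_F_mono[rotated]) simp
  note w' = w_ess_bounded[OF t']
  note int = integrableI[of _ "Suc t"]
  have "exp_dispersion y
      = 2 * N * (\<integral>\<omega>. (\<Sum>i\<in>UNIV. (norm (y i \<omega>))\<^sup>2) \<partial>M) - 2 * (\<integral>\<omega>. (norm (\<Sum>i\<in>UNIV. y i \<omega>))\<^sup>2 \<partial>M)"
  proof -
    have "integrable M (\<lambda>\<omega>. \<Sum>i\<in>UNIV. (norm (y i \<omega>))\<^sup>2)" "integrable M (\<lambda>\<omega>. (norm (\<Sum>i\<in>UNIV. y i \<omega>))\<^sup>2)"
      by (intro int ess_bounded_intros y)+
    then show ?thesis by (simp add: exp_dispersion_def dispersion_eq N_def)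
  qed
  also have "\<dots> \<le> 2 * N * ((\<integral>\<omega>. (\<Sum>j\<in>UNIV. (norm (u j \<omega>))\<^sup>2) \<partial>M) - \<gamma> / 2 * dissipation (Suc t) u)
      - 2 * (\<integral>\<omega>. (norm (s \<omega>))\<^sup>2 \<partial>M)"
  proof (intro diff_mono mult_left_mono)
    have "(\<integral>\<omega>. (\<Sum>i\<in>UNIV. (norm (y i \<omega>))\<^sup>2) \<partial>M)
        \<le> (\<integral>\<omega>. (\<Sum>i\<in>UNIV. \<Sum>j\<in>UNIV. w (Suc t) i j \<omega> * (norm (u j \<omega>))\<^sup>2)
            - \<gamma> / 2 * edge_energy (\<lambda>i j. w (Suc t) i j \<omega>) (\<lambda>i. u i \<omega>) \<partial>M)"
    proof (rule integral_mono_AE)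
      show "AE \<omega> in M. (\<Sum>i\<in>UNIV. (norm (y i \<omega>))\<^sup>2)
          \<le> (\<Sum>i\<in>UNIV. \<Sum>j\<in>UNIV. w (Suc t) i j \<omega> * (norm (u j \<omega>))\<^sup>2)
            - \<gamma> / 2 * edge_energy (\<lambda>i j. w (Suc t) i j \<omega>) (\<lambda>i. u i \<omega>)"
        using w_nonneg[OF t'] w_row[OF t'] w_loop[OF t']
      proof eventually_elim
        case (elim \<omega>)
        then show ?case
          unfolding y_def avg_def by (intro sum_norm_power2_averaging_le) auto
      qed
    qed (intro int ess_bounded_intros ess_bounded_edge_energy y w' u')+
    also have "\<dots> = (\<integral>\<omega>. (\<Sum>i\<in>UNIV. \<Sum>j\<in>UNIV. w (Suc t) i j \<omega> * (norm (u j \<omega>))\<^sup>2) \<partial>M)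
        - \<gamma> / 2 * dissipation (Suc t) u"
    proof -
      have "integrable M (\<lambda>\<omega>. \<Sum>i\<in>UNIV. \<Sum>j\<in>UNIV. w (Suc t) i j \<omega> * (norm (u j \<omega>))\<^sup>2)"
        "integrable M (\<lambda>\<omega>. edge_energy (\<lambda>i j. w (Suc t) i j \<omega>) (\<lambda>i. u i \<omega>))"
        by (intro int ess_bounded_intros ess_bounded_edge_energy w' u')+
      then show ?thesis by (simp add: dissipation_def)
    qed
    also have "(\<integral>\<omega>. (\<Sum>i\<in>UNIV. \<Sum>j\<in>UNIV. w (Suc t) i j \<omega> * (norm (u j \<omega>))\<^sup>2) \<partial>M)
        = (\<integral>\<omega>. (\<Sum>j\<in>UNIV. (norm (u j \<omega>))\<^sup>2) \<partial>M)"
      by (intro expectation_column[OF t] ess_bounded_intros u)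
    finally show "(\<integral>\<omega>. (\<Sum>i\<in>UNIV. (norm (y i \<omega>))\<^sup>2) \<partial>M)
        \<le> (\<integral>\<omega>. (\<Sum>j\<in>UNIV. (norm (u j \<omega>))\<^sup>2) \<partial>M) - \<gamma> / 2 * dissipation (Suc t) u" .
    have int_s: "integrable M (\<lambda>\<omega>. (norm (s \<omega>))\<^sup>2)"
      by (intro int ess_bounded_intros s')
    have int_ws: "integrable M (\<lambda>\<omega>. \<Sum>i\<in>UNIV. \<Sum>j\<in>UNIV. w (Suc t) i j \<omega> * (u j \<omega> \<bullet> s \<omega>))"
      by (intro int ess_bounded_intros w' u' s')
    \<comment> \<open>Jensen's inequality is obtained by testing the new total against
      \<open>s\<close>, which is known at time \<open>t\<close>: the expected inner product is that
      of \<open>s\<close> with itself.\<close>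
    have "(\<integral>\<omega>. (\<Sum>i\<in>UNIV. \<Sum>j\<in>UNIV. w (Suc t) i j \<omega> * (u j \<omega> \<bullet> s \<omega>)) \<partial>M)
        = (\<integral>\<omega>. (\<Sum>j\<in>UNIV. u j \<omega> \<bullet> s \<omega>) \<partial>M)"
      by (intro expectation_column[OF t] ess_bounded_intros u s)
    also have "\<dots> = (\<integral>\<omega>. (norm (s \<omega>))\<^sup>2 \<partial>M)"
      by (simp add: s_def power2_norm_eq_inner inner_sum_left)
    finally have "(\<integral>\<omega>. (norm (s \<omega>))\<^sup>2 \<partial>M)
        = (\<integral>\<omega>. 2 * (\<Sum>i\<in>UNIV. \<Sum>j\<in>UNIV. w (Suc t) i j \<omega> * (u j \<omega> \<bullet> s \<omega>)) - (norm (s \<omega>))\<^sup>2 \<partial>M)"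
      using int_s int_ws by simp
    \<comment> \<open>Pointwise this is the expansion of the nonnegative squared distance between
      the new total and \<open>s\<close>.\<close>
    also have "\<dots> \<le> (\<integral>\<omega>. (norm (\<Sum>i\<in>UNIV. y i \<omega>))\<^sup>2 \<partial>M)"
    proof (rule integral_mono)
      fix \<omega>
      have "(\<Sum>i\<in>UNIV. \<Sum>j\<in>UNIV. w (Suc t) i j \<omega> * (u j \<omega> \<bullet> s \<omega>)) = (\<Sum>i\<in>UNIV. y i \<omega>) \<bullet> s \<omega>"
        by (simp add: y_def avg_def inner_sum_left)
      then show "2 * (\<Sum>i\<in>UNIV. \<Sum>j\<in>UNIV. w (Suc t) i j \<omega> * (u j \<omega> \<bullet> s \<omega>)) - (norm (s \<omega>))\<^sup>2
          \<le> (norm (\<Sum>i\<in>UNIV. y i \<omega>))\<^sup>2"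
        using norm_diff_power2[of "\<Sum>i\<in>UNIV. y i \<omega>" "s \<omega>"]
          zero_le_power2[of "norm ((\<Sum>i\<in>UNIV. y i \<omega>) - s \<omega>)"] by linarith
    next
      show "integrable M (\<lambda>\<omega>. (norm (\<Sum>i\<in>UNIV. y i \<omega>))\<^sup>2)"
        by (intro int ess_bounded_intros y)
    qed (use int_s int_ws in auto)
    finally show "(\<integral>\<omega>. (norm (s \<omega>))\<^sup>2 \<partial>M) \<le> (\<integral>\<omega>. (norm (\<Sum>i\<in>UNIV. y i \<omega>))\<^sup>2 \<partial>M)" .
  qed (auto simp: N_def)
  also have "\<dots> = exp_dispersion u - N * \<gamma> * dissipation (Suc t) u"
  proof -
    have "integrable M (\<lambda>\<omega>. \<Sum>i\<in>UNIV. (norm (u i \<omega>))\<^sup>2)" "integrable M (\<lambda>\<omega>. (norm (s \<omega>))\<^sup>2)"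
      by (intro int ess_bounded_intros u' s')+
    then show ?thesis
      by (simp add: exp_dispersion_def dispersion_eq N_def s_def algebra_simps)
  qed
  finally show ?thesis by (simp add: y_def N_def)
qed

text \<open>Averaging without subgradient steps, the reference for the iterates inside a window. Its
  step \<open>k\<close> leads from time \<open>s + k\<close> to \<open>s + k + 1\<close> and uses
  the matrix of the latter time.\<close>

primrec run :: "nat \<Rightarrow> ('n \<Rightarrow> 'a \<Rightarrow> 'b::euclidean_space) \<Rightarrow> nat \<Rightarrow> 'n \<Rightarrow> 'a \<Rightarrow> 'b" where
  "run s u 0 = u"
| "run s u (Suc k) = avg (Suc (s + k)) (run s u k)"

lemma run_ess_bounded:
  assumes "t0 \<le> s" "\<And>i. u i \<in> ess_bounded M (F s)"
  shows "run s u k i \<in> ess_bounded M (F (s + k))"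
proof (induction k arbitrary: i)
  case (Suc k)
  then show ?case
    using assms(1) avg_ess_bounded[of "Suc (s + k)" "run s u k" "s + k" i] by simp
qed (use assms in simp)

lemma exp_dispersion_run_le:
  fixes u :: "'n \<Rightarrow> 'a \<Rightarrow> 'b::euclidean_space"
  assumes "t0 \<le> s" "\<And>i. u i \<in> ess_bounded M (F s)"
  shows "exp_dispersion (run s u k)
    \<le> exp_dispersion u - real CARD('n) * \<gamma> * (\<Sum>l<k. dissipation (Suc (s + l)) (run s u l))"
proof (induction k)
  case (Suc k)
  have "exp_dispersion (run s u (Suc k))
      \<le> exp_dispersion (run s u k) - real CARD('n) * \<gamma> * dissipation (Suc (s + k)) (run s u k)"
    using exp_dispersion_avg_le[of "s + k" "run s u k"] run_ess_bounded[OF assms] assms(1) by simp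
  with Suc show ?case by (simp add: algebra_simps)
qed simp

definition connected_window :: "nat \<Rightarrow> nat \<Rightarrow> bool" where
  "connected_window s B \<longleftrightarrow> (AE \<omega> in M. has_spanning_rooted_tree
    (\<Union>k<B. {(j, i). \<gamma> < real_cond_exp M (F s) (w (Suc (s + k)) i j) \<omega>}))"

text \<open>Since \<open>u\<close> is known at time \<open>s\<close>, the weights may be replaced by their conditional
  expectations in \<open>dissipation\<close>; this is the only use of the connectivity of the conditional
  graphs.\<close>

lemma exp_dispersion_le_dissipation:
  fixes u :: "'n \<Rightarrow> 'a \<Rightarrow> 'b::euclidean_space"
  assumes s: "t0 \<le> s" and u: "\<And>i. u i \<in> ess_bounded M (F s)" and conn: "connected_window s B"
  shows "exp_dispersion u \<le> 4 * real CARD('n) ^ 6 / \<gamma> * (\<Sum>k<B. dissipation (Suc (s + k)) u)"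
proof -
  define P where "P k i j = real_cond_exp M (F s) (w (Suc (s + k)) i j)" for k i j
  define d where "d i j \<omega> = (norm (u i \<omega> - u j \<omega>))\<^sup>2" for i j \<omega>
  have d: "d i j \<in> ess_bounded M (F s)" for i j
    unfolding d_def[abs_def] by (intro ess_bounded_intros u)
  have w_int: "integrable M (w (Suc (s + k)) i j)" for k i j
    using s by (intro integrableI[OF w_ess_bounded]) auto
  have dw_int: "integrable M (\<lambda>\<omega>. d i j \<omega> * w (Suc (s + k)) i j \<omega>)" for k i j
    using ess_bounded_F_mono[OF _ d] s
    by (intro integrableI[of _ "Suc (s + k)"] ess_bounded_mult w_ess_bounded) auto
  note dP = cond_exp_mult[OF d dw_int, folded P_def]
  have "AE \<omega> in M. \<forall>k i j. 0 \<le> P k i j \<omega>"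
  proof -
    interpret finite_measure_subalgebra M "F s"
      by unfold_locales (rule subalg)
    have "AE \<omega> in M. 0 \<le> P k i j \<omega>" for k i j
      unfolding P_def using w_nonneg[of "Suc (s + k)"] s w_int[of k i j]
      by (intro real_cond_exp_pos) (auto elim!: eventually_mono)
    then show ?thesis by (simp add: AE_all_countable)
  qed
  with conn[unfolded connected_window_def]
  have "AE \<omega> in M. dispersion (\<lambda>i. u i \<omega>)
      \<le> 4 * real CARD('n) ^ 6 * ((\<Sum>k<B. \<Sum>i\<in>UNIV. \<Sum>j\<in>UNIV. d i j \<omega> * P k i j \<omega>) / \<gamma>)"
  proof eventually_elim
    case (elim \<omega>)
    have nonneg: "0 \<le> d i j \<omega> * P k i j \<omega>" for i j k
      using elim(2) by (simp add: d_def)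
    show ?case
    \<comment> \<open>The tree depends on the sample point, so the bound is applied pathwise. A tree
      edge has conditional weight above \<open>\<gamma>\<close> at some time of the window, so the
      total conditional energy over \<open>\<gamma>\<close> bounds its squared length.\<close>
    proof (rule dispersion_le_of_spanning_tree[OF elim(1)])
      fix i j
      assume "(j, i) \<in> (\<Union>k<B. {(j, i). \<gamma> < real_cond_exp M (F s) (w (Suc (s + k)) i j) \<omega>})"
      then obtain k where k: "k < B" "\<gamma> < P k i j \<omega>" by (auto simp: P_def)
      have "d i j \<omega> * \<gamma> \<le> d i j \<omega> * P k i j \<omega>"
        using k by (intro mult_left_mono) (auto simp: d_def)
      also have "\<dots> \<le> (\<Sum>j\<in>UNIV. d i j \<omega> * P k i j \<omega>)"
        using nonneg by (intro member_le_sum[where f = "\<lambda>j. d i j \<omega> * P k i j \<omega>"]) auto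
      also have "\<dots> \<le> (\<Sum>i\<in>UNIV. \<Sum>j\<in>UNIV. d i j \<omega> * P k i j \<omega>)"
        using nonneg
        by (intro member_le_sum[where f = "\<lambda>i. \<Sum>j\<in>UNIV. d i j \<omega> * P k i j \<omega>"] sum_nonneg) auto
      also have "\<dots> \<le> (\<Sum>k<B. \<Sum>i\<in>UNIV. \<Sum>j\<in>UNIV. d i j \<omega> * P k i j \<omega>)"
        using nonneg k
        by (intro member_le_sum[where f = "\<lambda>k. \<Sum>i\<in>UNIV. \<Sum>j\<in>UNIV. d i j \<omega> * P k i j \<omega>"]
            sum_nonneg) auto
      finally show "(norm (u i \<omega> - u j \<omega>))\<^sup>2
          \<le> (\<Sum>k<B. \<Sum>i\<in>UNIV. \<Sum>j\<in>UNIV. d i j \<omega> * P k i j \<omega>) / \<gamma>"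
        using gamma by (simp add: pos_le_divide_eq d_def)
    qed (use gamma nonneg in \<open>auto intro!: divide_nonneg_pos sum_nonneg\<close>)
  qed
  then have "exp_dispersion u
      \<le> (\<integral>\<omega>. 4 * real CARD('n) ^ 6 * ((\<Sum>k<B. \<Sum>i\<in>UNIV. \<Sum>j\<in>UNIV. d i j \<omega> * P k i j \<omega>) / \<gamma>) \<partial>M)"
    unfolding exp_dispersion_def using dP(1)
    by (intro integral_mono_AE integrableI[OF ess_bounded_dispersion[OF u]]) auto
  also have "\<dots> = 4 * real CARD('n) ^ 6 / \<gamma> * (\<Sum>k<B. \<Sum>i\<in>UNIV. \<Sum>j\<in>UNIV. \<integral>\<omega>. d i j \<omega> * P k i j \<omega> \<partial>M)"
    using dP(1) by (simp add: Bochner_Integration.integral_sum)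
  also have "(\<Sum>k<B. \<Sum>i\<in>UNIV. \<Sum>j\<in>UNIV. \<integral>\<omega>. d i j \<omega> * P k i j \<omega> \<partial>M)
      = (\<Sum>k<B. dissipation (Suc (s + k)) u)"
  proof (intro sum.cong refl)
    fix k
    have "dissipation (Suc (s + k)) u
        = (\<integral>\<omega>. (\<Sum>i\<in>UNIV. \<Sum>j\<in>UNIV. d i j \<omega> * w (Suc (s + k)) i j \<omega>) \<partial>M)"
      by (simp add: dissipation_def edge_energy_def d_def mult.commute)
    then show "(\<Sum>i\<in>UNIV. \<Sum>j\<in>UNIV. \<integral>\<omega>. d i j \<omega> * P k i j \<omega> \<partial>M) = dissipation (Suc (s + k)) u"
      using dw_int dP(2) by (simp add: Bochner_Integration.integral_sum)
  qed
  finally show ?thesis .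
qed

text \<open>With N the number of nodes, a window lowers the expected dispersion by N \<gamma> Q,
  where Q is what it dissipates. Initially the dispersion is at most 4 N^6 / \<gamma> (spanning
  tree) times 3 B N^2 (1 + 2 B) (moving state) times Q. The rate is the quotient of the two factors
  of Q.\<close>

definition rate :: "nat \<Rightarrow> real" where
  "rate B = \<gamma>\<^sup>2 / (12 * real CARD('n) ^ 7 * real B * (1 + 2 * real B))"

lemma rate_bounds:
  assumes "0 < B"
  shows "0 < rate B" "rate B \<le> 1"
proof -
  define p x where "p = real CARD('n) ^ 7" and "x = real B"
  have p: "1 \<le> p"
    unfolding p_def by (intro one_le_power) (simp add: Suc_le_eq)
  have x: "1 \<le> x"
    unfolding x_def using assms by simp
  have "1 * 1 * 1 \<le> (12 * p) * x * (1 + 2 * x)"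
    using p x by (intro mult_mono) auto
  moreover have "\<gamma>\<^sup>2 \<le> 1" using gamma by (simp add: power_le_one)
  moreover have "0 < \<gamma>\<^sup>2" using gamma by simp
  ultimately show "0 < rate B" "rate B \<le> 1"
    unfolding rate_def p_def[symmetric] x_def[symmetric]
    by (simp_all add: divide_le_eq zero_less_divide_iff)
qed

lemma exp_dispersion_window:
  fixes u :: "'n \<Rightarrow> 'a \<Rightarrow> 'b::euclidean_space"
  assumes s: "t0 \<le> s" and u: "\<And>i. u i \<in> ess_bounded M (F s)" and conn: "connected_window s B"
    and "0 < B"
  shows "exp_dispersion (run s u B) \<le> (1 - rate B) * exp_dispersion u"
proof -
  define N where "N = real CARD('n)"
  have N: "0 < N" unfolding N_def by (simp only: of_nat_0_less_iff zero_less_card_finite)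
  define c where "c = real B * N\<^sup>2 * (3 * (1 + 2 * real B))"
  define Q where "Q = (\<Sum>k<B. dissipation (Suc (s + k)) (run s u k))"
  have run_k: "run s u k i \<in> ess_bounded M (F (s + k))" for k i
    using s u by (rule run_ess_bounded)
  have run: "run s u k i \<in> ess_bounded M (F (s + B))" if "k < B" for k i
    by (rule ess_bounded_F_mono[OF _ run_k]) (use that in simp)
  have w: "w (Suc (s + k)) i j \<in> ess_bounded M (F (s + B))" if "k < B" for k i j
    by (rule ess_bounded_F_mono[OF _ w_ess_bounded]) (use s that in simp_all)
  \<comment> \<open>The weights of step \<open>k\<close> at the state of step \<open>l\<close>:
    connectivity controls the terms \<open>E k 0\<close>, the dissipation consists of the terms
    \<open>E k k\<close>.\<close>
  define E :: "nat \<Rightarrow> nat \<Rightarrow> 'a \<Rightarrow> real" where "E k l \<omega> = edge_energy (\<lambda>i j. w (Suc (s + k)) i j \<omega>) (\<lambda>i. run s u l i \<omega>)" for k l \<omega>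
  have E_int: "integrable M (E k l)" if "k < B" "l < B" for k l
    unfolding E_def[abs_def]
    by (intro integrableI[of _ "s + B"] ess_bounded_edge_energy w[OF that(1)] run[OF that(2)])
  have "(\<Sum>k<B. dissipation (Suc (s + k)) u) = (\<integral>\<omega>. (\<Sum>k<B. E k 0 \<omega>) \<partial>M)"
    using E_int by (simp add: Bochner_Integration.integral_sum) (simp add: dissipation_def E_def)
  also have "\<dots> \<le> (\<integral>\<omega>. c * (\<Sum>k<B. E k k \<omega>) \<partial>M)"
  proof (rule integral_mono_AE)
    have "AE \<omega> in M. \<forall>k i j. 0 \<le> w (Suc (s + k)) i j \<omega>" "AE \<omega> in M. \<forall>k i. (\<Sum>j\<in>UNIV. w (Suc (s + k)) i j \<omega>) = 1"
      using w_nonneg[of "Suc (s + k)" for k] w_row[of "Suc (s + k)" for k] s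
      by (simp_all add: AE_all_countable)
    then show "AE \<omega> in M. (\<Sum>k<B. E k 0 \<omega>) \<le> c * (\<Sum>k<B. E k k \<omega>)"
    proof eventually_elim
      case (elim \<omega>)
      then show ?case
        unfolding E_def c_def N_def
        by (intro initial_edge_energy_le_dissipation) (simp_all add: avg_def)
    qed
  qed (use E_int in auto)
  also have "\<dots> = c * Q"
    using E_int by (simp add: Bochner_Integration.integral_sum Q_def dissipation_def E_def[abs_def])
  finally have "4 * N ^ 6 / \<gamma> * (\<Sum>k<B. dissipation (Suc (s + k)) u) \<le> 4 * N ^ 6 / \<gamma> * (c * Q)"
    using gamma N by (intro mult_left_mono) auto
  with exp_dispersion_le_dissipation[OF s u conn]
  have "exp_dispersion u \<le> 4 * N ^ 6 / \<gamma> * (c * Q)"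
    unfolding N_def by (rule order_trans)
  then have "rate B * exp_dispersion u \<le> rate B * (4 * N ^ 6 / \<gamma> * (c * Q))"
    using rate_bounds[OF \<open>0 < B\<close>] by (intro mult_left_mono) auto
  also have "\<dots> = N * \<gamma> * Q"
  proof -
    \<comment> \<open>Here \<open>a\<close>, \<open>a'\<close>, \<open>p\<close>, \<open>x\<close>,
      \<open>b\<close> stand for N^6, N^2, N^7, B and 1 + 2 B.\<close>
    have alg: "\<gamma>\<^sup>2 / (12 * p * x * b) * (4 * a / \<gamma> * (x * a' * (3 * b) * Q)) = N * \<gamma> * Q"
      if "a * a' = N * p" "p \<noteq> 0" "x \<noteq> 0" "b \<noteq> 0" for a a' p x b :: real
    proof -
      have "\<gamma>\<^sup>2 / (12 * p * x * b) * (4 * a / \<gamma> * (x * a' * (3 * b) * Q)) = (a * a') / p * (\<gamma> * Q)"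
        using that(2-4) gamma by (simp add: divide_simps power2_eq_square)
      also have "\<dots> = N * \<gamma> * Q"
        unfolding that(1) using that(2) by simp
      finally show ?thesis .
    qed
    show ?thesis
      unfolding rate_def c_def N_def[symmetric] using N \<open>0 < B\<close>
      by (intro alg) (auto simp flip: power_add power_Suc)
  qed
  finally show ?thesis
    using exp_dispersion_run_le[where u = u and k = B, OF s u] by (simp add: Q_def N_def algebra_simps)
qed

end

section \<open>Expected dispersion of averaging with small perturbations\<close>

lemma summable_blocks:
  fixes a :: "nat \<Rightarrow> real"
  assumes nonneg: "\<And>n. 0 \<le> a n" and "0 < B"
  shows "summable (\<lambda>k. \<Sum>l<B. a (k * B + l)) \<longleftrightarrow> summable a"
proof -
  have block: "(\<Sum>l<B. a (k * B + l)) = sum a {k * B..<k * B + B}" for k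
    by (simp add: sum.atLeastLessThan_shift_0[of a "k * B"] atLeast0LessThan)
  then have partial: "(\<Sum>k<n. \<Sum>l<B. a (k * B + l)) = sum a {..<n * B}" for n
    by (simp add: sum.nat_group)
  show ?thesis
  proof
    assume *: "summable (\<lambda>k. \<Sum>l<B. a (k * B + l))"
    show "summable a"
    proof (rule summableI_nonneg_bounded[OF nonneg])
      fix n
      have "sum a {..<n} \<le> sum a {..<n * B}"
        using nonneg \<open>0 < B\<close> by (intro sum_mono2) auto
      also have "\<dots> \<le> (\<Sum>k. \<Sum>l<B. a (k * B + l))"
        unfolding partial[symmetric] using nonneg by (intro sum_le_suminf[OF *]) (auto intro: sum_nonneg)
      finally show "sum a {..<n} \<le> (\<Sum>k. \<Sum>l<B. a (k * B + l))" .
    qed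
  next
    assume *: "summable a"
    show "summable (\<lambda>k. \<Sum>l<B. a (k * B + l))"
    proof (rule summableI_nonneg_bounded)
      show "(\<Sum>k<n. \<Sum>l<B. a (k * B + l)) \<le> suminf a" for n
        unfolding partial using nonneg by (intro sum_le_suminf[OF *]) auto
    qed (use nonneg in \<open>auto intro: sum_nonneg\<close>)
  qed
qed

text \<open>For the dispersion only the size of \<open>g\<close> matters; that it consists of
  subgradients enters later.\<close>

locale perturbed_averaging = random_averaging M F w \<gamma> t0
  for M :: "'a measure" and F :: "nat \<Rightarrow> 'a measure"
    and w :: "nat \<Rightarrow> 'n::finite \<Rightarrow> 'n \<Rightarrow> 'a \<Rightarrow> real" and \<gamma> :: real and t0 :: nat +
  fixes x g :: "nat \<Rightarrow> 'n \<Rightarrow> 'a \<Rightarrow> 'b::euclidean_space" and \<alpha> :: "nat \<Rightarrow> real" and G :: real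
    and B :: nat
  assumes x_init: "\<And>i. x t0 i \<in> ess_bounded M (F t0)"
    and x_step: "\<And>t i \<omega>. t0 \<le> t \<Longrightarrow> \<omega> \<in> space M \<Longrightarrow>
      x (Suc t) i \<omega> = avg (Suc t) (x t) i \<omega> - \<alpha> t *\<^sub>R g t i \<omega>"
    and g_measurable: "\<And>t i. t0 \<le> t \<Longrightarrow> g t i \<in> borel_measurable (F t)"
    and g_bound: "\<And>t. t0 \<le> t \<Longrightarrow> AE \<omega> in M. \<forall>i. norm (g t i \<omega>) \<le> G"
    and alpha_nonneg: "\<And>t. t0 \<le> t \<Longrightarrow> 0 \<le> \<alpha> t"
    and alpha_square_summable: "summable (\<lambda>t. (\<alpha> (t0 + t))\<^sup>2)"
    and G_nonneg: "0 \<le> G"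
    and B_pos: "0 < B"
    and connected: "\<And>t. t0 \<le> t \<Longrightarrow> connected_window (t * B) B"
begin

lemma space_F: "space (F t) = space M"
  using subalg[of t] by (simp add: subalgebra_def)

lemma g_ess_bounded: "t0 \<le> t \<Longrightarrow> g t i \<in> ess_bounded M (F t)"
  using g_bound[of t] by (intro ess_boundedI[OF g_measurable, where C = G]) (auto elim!: eventually_mono)

text \<open>A bounded start and bounded increments give each time its own bound; none uniform in
  time is claimed.\<close>

lemma x_ess_bounded:
  assumes "t0 \<le> t"
  shows "x t i \<in> ess_bounded M (F t)"
  using assms
proof (induction t arbitrary: i rule: dec_induct)
  case (step t)
  have *: "(\<lambda>\<omega>. avg (Suc t) (x t) i \<omega> - \<alpha> t *\<^sub>R g t i \<omega>) \<in> ess_bounded M (F (Suc t))"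
    using step g_ess_bounded[of t i]
    by (intro ess_bounded_intros avg_ess_bounded[of _ _ t]) (auto intro: ess_bounded_F_mono[of t])
  then obtain C where C: "(\<lambda>\<omega>. avg (Suc t) (x t) i \<omega> - \<alpha> t *\<^sub>R g t i \<omega>) \<in> borel_measurable (F (Suc t))"
    "AE \<omega> in M. norm (avg (Suc t) (x t) i \<omega> - \<alpha> t *\<^sub>R g t i \<omega>) \<le> C"
    by (rule ess_boundedE)
  show ?case
  proof (rule ess_boundedI)
    show "x (Suc t) i \<in> borel_measurable (F (Suc t))"
      using C(1) by (rule measurable_cong[THEN iffD1, rotated]) (simp add: space_F x_step step)
    show "AE \<omega> in M. norm (x (Suc t) i \<omega>) \<le> C"
      using C(2) AE_space by eventually_elim (simp add: x_step step)
  qed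
qed (rule x_init)

text \<open>The iterates and the reference run use the same realized weights, and averaging with
  stochastic rows does not increase the largest deviation, so the subgradient steps merely add
  up.\<close>

lemma deviation_bound:
  assumes s: "t0 \<le> s"
  shows "AE \<omega> in M. \<forall>i. norm (x (s + k) i \<omega> - run s (x s) k i \<omega>) \<le> G * (\<Sum>l<k. \<alpha> (s + l))"
proof (induction k)
  case (Suc k)
  define d where "d = G * (\<Sum>l<k. \<alpha> (s + l))"
  have t: "t0 \<le> s + k" "t0 \<le> Suc (s + k)" using s by auto
  from Suc show ?case
    using AE_space w_nonneg[OF t(2)] w_row[OF t(2)] g_bound[OF t(1)]
  proof eventually_elim
    case (elim \<omega>)
    define p where "p i j = w (Suc (s + k)) i j \<omega>" for i j
    have "norm (x (s + Suc k) i \<omega> - run s (x s) (Suc k) i \<omega>) \<le> G * (\<Sum>l<Suc k. \<alpha> (s + l))" for i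
    proof -
      have "x (s + Suc k) i \<omega> - run s (x s) (Suc k) i \<omega>
          = (\<Sum>j\<in>UNIV. p i j *\<^sub>R (x (s + k) j \<omega> - run s (x s) k j \<omega>)) - \<alpha> (s + k) *\<^sub>R g (s + k) i \<omega>"
        using x_step[OF t(1) elim(2), of i]
        by (simp add: avg_def p_def scaleR_diff_right sum_subtractf)
      also have "norm \<dots> \<le> norm (\<Sum>j\<in>UNIV. p i j *\<^sub>R (x (s + k) j \<omega> - run s (x s) k j \<omega>))
          + norm (\<alpha> (s + k) *\<^sub>R g (s + k) i \<omega>)"
        by (rule norm_triangle_ineq4)
      also have "norm (\<Sum>j\<in>UNIV. p i j *\<^sub>R (x (s + k) j \<omega> - run s (x s) k j \<omega>)) \<le> (\<Sum>j\<in>UNIV. p i j * d)"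
        using elim by (intro sum_norm_le) (auto simp: p_def d_def intro!: mult_left_mono)
      also have "\<dots> = d" using elim by (simp add: sum_distrib_right[symmetric] p_def)
      also have "norm (\<alpha> (s + k) *\<^sub>R g (s + k) i \<omega>) \<le> \<alpha> (s + k) * G"
        using elim alpha_nonneg[OF t(1)] by (simp add: mult_left_mono)
      finally show ?thesis by (simp add: d_def algebra_simps)
    qed
    then show ?case ..
  qed
qed simp

text \<open>Both ends of a pair may deviate by G times the sum of the steps. Squaring gives
  \<open>4 * G\<^sup>2\<close>, and Cauchy-Schwarz over at most \<open>B\<close> steps gives the
  factor \<open>B\<close>.\<close>

lemma exp_dispersion_perturb:
  assumes s: "t0 \<le> s" and "k \<le> B" and "0 < e"
  shows "exp_dispersion (x (s + k)) \<le> (1 + e) * exp_dispersion (run s (x s) k)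
    + (1 + 1 / e) * (real CARD('n))\<^sup>2 * (4 * G\<^sup>2 * real B) * (\<Sum>l<B. (\<alpha> (s + l))\<^sup>2)"
proof -
  define d where "d = G * (\<Sum>l<k. \<alpha> (s + l))"
  have x: "x (s + k) i \<in> ess_bounded M (F (s + k))" for i
    using s by (intro x_ess_bounded) simp
  have r: "run s (x s) k i \<in> ess_bounded M (F (s + k))" for i
    using s x_ess_bounded[OF s] by (rule run_ess_bounded)
  have r_int: "integrable M (\<lambda>\<omega>. dispersion (\<lambda>i. run s (x s) k i \<omega>))"
    by (intro integrableI[of _ "s + k"] ess_bounded_dispersion r)
  have "exp_dispersion (x (s + k)) \<le> (\<integral>\<omega>. (1 + e) * dispersion (\<lambda>i. run s (x s) k i \<omega>)
      + (1 + 1 / e) * (real CARD('n))\<^sup>2 * (2 * d)\<^sup>2 \<partial>M)"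
    unfolding exp_dispersion_def
  proof (rule integral_mono_AE)
    show "AE \<omega> in M. dispersion (\<lambda>i. x (s + k) i \<omega>) \<le> (1 + e) * dispersion (\<lambda>i. run s (x s) k i \<omega>)
        + (1 + 1 / e) * (real CARD('n))\<^sup>2 * (2 * d)\<^sup>2"
      using deviation_bound[OF s, of k]
      by eventually_elim (intro dispersion_perturb[OF \<open>0 < e\<close>], simp add: d_def)
    show "integrable M (\<lambda>\<omega>. dispersion (\<lambda>i. x (s + k) i \<omega>))"
      by (intro integrableI[of _ "s + k"] ess_bounded_dispersion x)
  qed (use r_int in simp)
  also have "\<dots> = (1 + e) * exp_dispersion (run s (x s) k)
      + (1 + 1 / e) * (real CARD('n))\<^sup>2 * (2 * d)\<^sup>2"
    using r_int by (simp add: exp_dispersion_def prob_space)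
  also have "(2 * d)\<^sup>2 \<le> (4 * G\<^sup>2 * real B) * (\<Sum>l<B. (\<alpha> (s + l))\<^sup>2)"
  proof -
    have "(\<Sum>l<k. \<alpha> (s + l))\<^sup>2 \<le> (\<Sum>l<k. (\<alpha> (s + l))\<^sup>2) * real k"
      using sum_squared_le_sum_of_squares[of "\<lambda>l. \<alpha> (s + l)" "{..<k}"] by simp
    also have "\<dots> \<le> (\<Sum>l<B. (\<alpha> (s + l))\<^sup>2) * real B"
      using \<open>k \<le> B\<close> by (intro mult_mono sum_mono2 sum_nonneg) auto
    finally have "4 * G\<^sup>2 * (\<Sum>l<k. \<alpha> (s + l))\<^sup>2 \<le> 4 * G\<^sup>2 * ((\<Sum>l<B. (\<alpha> (s + l))\<^sup>2) * real B)"
      by (intro mult_left_mono) auto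
    then show ?thesis by (simp add: d_def power_mult_distrib mult_ac)
  qed
  finally show ?thesis
    using \<open>0 < e\<close> by (simp add: mult.assoc mult_left_mono)
qed

lemma alpha_square_summable_shift: "summable (\<lambda>n. (\<alpha> (t0 * B + n))\<^sup>2)"
proof -
  \<comment> \<open>The difference is a true one: \<open>B\<close> is positive, so
    \<open>t0 * B\<close> is at least \<open>t0\<close>.\<close>
  have eq: "t0 * B + n = t0 + (n + (t0 * B - t0))" for n
    using B_pos by (cases B) auto
  show ?thesis
    unfolding eq using summable_iff_shift[of "\<lambda>t. (\<alpha> (t0 + t))\<^sup>2" "t0 * B - t0"] alpha_square_summable by simp
qed

theorem exp_dispersion_summable: "summable (\<lambda>n. exp_dispersion (x (t0 * B + n)))"
proof -
  define \<theta> where "\<theta> = rate B"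
  have \<theta>: "0 < \<theta>" "\<theta> \<le> 1" unfolding \<theta>_def using rate_bounds[OF B_pos] by auto
  \<comment> \<open>Windows are known to be connected from index \<open>t0\<close> on, so the first
    usable one starts at time \<open>t0 * B\<close>.\<close>
  define s where "s k = (t0 + k) * B" for k
  have s: "t0 \<le> s k" for k
    unfolding s_def using B_pos by (metis le_add1 mult.right_neutral mult_le_mono Suc_leI One_nat_def)
  define A where "A k = (\<Sum>l<B. (\<alpha> (s k + l))\<^sup>2)" for k
  have A_nonneg: "0 \<le> A k" for k unfolding A_def by (intro sum_nonneg) auto
  have s_eq: "s k + l = t0 * B + (k * B + l)" for k l
    by (simp add: s_def algebra_simps)
  have A: "summable A"
    unfolding A_def s_eq using alpha_square_summable_shift B_pos
    by (subst summable_blocks[where a = "\<lambda>n. (\<alpha> (t0 * B + n))\<^sup>2"]) auto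
  define C where "C e = (1 + 1 / e) * (real CARD('n))\<^sup>2 * (4 * G\<^sup>2 * real B)" for e
  have C_nonneg: "0 \<le> C e" if "0 < e" for e unfolding C_def using that by simp
  have perturb: "exp_dispersion (x (s k + l)) \<le> (1 + e) * exp_dispersion (run (s k) (x (s k)) l) + C e * A k"
    if "l \<le> B" "0 < e" for k l e
    using exp_dispersion_perturb[OF s that] by (simp add: C_def A_def)
  note x_s = x_ess_bounded[OF s]
  have windows: "summable (\<lambda>k. exp_dispersion (x (s k)))"
  proof (rule summable_of_contraction)
    \<comment> \<open>Taking \<open>e = \<theta> / 2\<close> sacrifices half of the contraction to
      the perturbation: (1 + \<theta>/2) (1 - \<theta>) \<le> 1 - \<theta>/2.\<close>
    show "exp_dispersion (x (s (Suc k)))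
        \<le> (1 - \<theta> / 2) * exp_dispersion (x (s k)) + C (\<theta> / 2) * A k" for k
    proof -
      have "connected_window (s k) B" unfolding s_def by (intro connected) simp
      then have "exp_dispersion (run (s k) (x (s k)) B) \<le> (1 - \<theta>) * exp_dispersion (x (s k))"
        unfolding \<theta>_def using s x_s B_pos by (intro exp_dispersion_window)
      then have "(1 + \<theta> / 2) * exp_dispersion (run (s k) (x (s k)) B)
          \<le> (1 + \<theta> / 2) * ((1 - \<theta>) * exp_dispersion (x (s k)))"
        using \<theta> by (intro mult_left_mono) auto
      also have "\<dots> = (1 - \<theta> / 2 - \<theta>\<^sup>2 / 2) * exp_dispersion (x (s k))"
        by (simp add: algebra_simps power2_eq_square)
      also have "\<dots> \<le> (1 - \<theta> / 2) * exp_dispersion (x (s k))"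
        by (intro mult_right_mono) auto
      finally show ?thesis
        using perturb[of B "\<theta> / 2" k] \<theta> by (simp add: s_def algebra_simps)
    qed
    show "summable (\<lambda>k. C (\<theta> / 2) * A k)" by (intro summable_mult A)
  qed (use \<theta> A_nonneg C_nonneg in auto)
  have "summable (\<lambda>k. \<Sum>l<B. exp_dispersion (x (t0 * B + (k * B + l))))"
  proof (rule summable_comparison_test')
    show "summable (\<lambda>k. real B * (2 * exp_dispersion (x (s k)) + C 1 * A k))"
      by (intro summable_mult summable_add windows A)
    show "norm (\<Sum>l<B. exp_dispersion (x (t0 * B + (k * B + l))))
        \<le> real B * (2 * exp_dispersion (x (s k)) + C 1 * A k)" for k
    proof -
      \<comment> \<open>Inside a window no decrease is required, so \<open>e = 1\<close> will do; it
        is the origin of the factor 2.\<close>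
      have "exp_dispersion (x (s k + l)) \<le> 2 * exp_dispersion (x (s k)) + C 1 * A k" if "l < B" for l
      proof -
        have "exp_dispersion (run (s k) (x (s k)) l) \<le> exp_dispersion (x (s k))
            - real CARD('n) * \<gamma> * (\<Sum>m<l. dissipation (Suc (s k + m)) (run (s k) (x (s k)) m))"
          using s x_s by (rule exp_dispersion_run_le)
        moreover have "0 \<le> real CARD('n) * \<gamma> * (\<Sum>m<l. dissipation (Suc (s k + m)) (run (s k) (x (s k)) m))"
          using gamma s[of k] by (intro mult_nonneg_nonneg sum_nonneg dissipation_nonneg) auto
        ultimately show ?thesis
          using perturb[of l 1 k] that by simp
      qed
      then have "(\<Sum>l<B. exp_dispersion (x (s k + l))) \<le> (\<Sum>l<B. 2 * exp_dispersion (x (s k)) + C 1 * A k)"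
        by (intro sum_mono) auto
      then show ?thesis unfolding s_eq by (simp add: sum_nonneg)
    qed
  qed
  then show ?thesis
    using B_pos by (subst (asm) summable_blocks[where a = "\<lambda>n. exp_dispersion (x (t0 * B + n))"]) auto
qed

end

subsection \<open>The subgradient iteration\<close>

text \<open>The subgradient of \<open>f i\<close> is taken at \<open>u i\<close>, but the step
  starts from the average, and the objective needs all \<open>f i\<close> at the common point
  \<open>u i0\<close>. Each of the two changes of point costs at most G times the square root of the
  dispersion.\<close>

lemma subgradient_step_drift:
  fixes u h :: "'n::finite \<Rightarrow> 'b::euclidean_space" and f :: "'n \<Rightarrow> 'b \<Rightarrow> real" and i0 :: 'n
  assumes nonneg: "\<And>i j. 0 \<le> p i j" and row: "\<And>i. (\<Sum>j\<in>UNIV. p i j) = 1"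
    and lip: "\<And>i y z. \<bar>f i y - f i z\<bar> \<le> G * norm (y - z)"
    and sub: "\<And>i. subgradient (f i) (u i) (h i)" and bound: "\<And>i. norm (h i) \<le> G" and "0 \<le> a"
  shows "(\<Sum>i\<in>UNIV. (norm ((\<Sum>j\<in>UNIV. p i j *\<^sub>R u j) - a *\<^sub>R h i - z))\<^sup>2)
    \<le> (\<Sum>i\<in>UNIV. \<Sum>j\<in>UNIV. p i j * (norm (u j - z))\<^sup>2)
      - 2 * a * ((\<Sum>i\<in>UNIV. f i (u i0)) - (\<Sum>i\<in>UNIV. f i z))
      + real CARD('n) * (2 * G + G\<^sup>2) * (a\<^sup>2 + dispersion u)"
proof -
  define D where "D = sqrt (dispersion u)"
  have D2: "D\<^sup>2 = dispersion u" by (simp add: D_def)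
  have "0 \<le> D" by (simp add: D_def)
  have "0 \<le> G" using bound[of i0] norm_ge_zero order_trans by blast
  have "(norm ((\<Sum>j\<in>UNIV. p i j *\<^sub>R u j) - a *\<^sub>R h i - z))\<^sup>2
      \<le> (\<Sum>j\<in>UNIV. p i j * (norm (u j - z))\<^sup>2) - 2 * a * (f i (u i0) - f i z)
        + (2 * G + G\<^sup>2) * (a\<^sup>2 + dispersion u)" for i
  proof -
    define y where "y = (\<Sum>j\<in>UNIV. p i j *\<^sub>R u j)"
    have y_diff: "y - v = (\<Sum>j\<in>UNIV. p i j *\<^sub>R (u j - v))" for v
      by (simp add: y_def scaleR_diff_right sum_subtractf scaleR_sum_left[symmetric] row)
    have "norm (y - u i) \<le> (\<Sum>j\<in>UNIV. p i j * D)"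
      unfolding y_diff using nonneg norm_diff_le_sqrt_dispersion[of u]
      by (intro sum_norm_le) (auto simp: D_def intro!: mult_left_mono)
    then have y_u: "norm (y - u i) \<le> D"
      by (simp add: sum_distrib_right[symmetric] row)
    have "h i \<bullet> (y - u i) \<ge> - (G * D)"
    proof -
      have "\<bar>h i \<bullet> (y - u i)\<bar> \<le> norm (h i) * norm (y - u i)" by (rule Cauchy_Schwarz_ineq2)
      also have "\<dots> \<le> G * D" using y_u bound \<open>0 \<le> G\<close> by (intro mult_mono) auto
      finally show ?thesis by linarith
    qed
    moreover have "h i \<bullet> (u i - z) \<ge> f i (u i) - f i z"
      using sub[of i] by (auto simp: subgradient_def inner_diff_right dest!: spec[of _ z])
    moreover have "f i (u i) \<ge> f i (u i0) - G * D"
      using lip[of i "u i" "u i0"] mult_left_mono[OF norm_diff_le_sqrt_dispersion[of u i i0] \<open>0 \<le> G\<close>]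
      by (simp add: D_def)
    moreover have "h i \<bullet> (y - z) = h i \<bullet> (y - u i) + h i \<bullet> (u i - z)"
      by (simp add: inner_diff_right)
    ultimately have "h i \<bullet> (y - z) \<ge> f i (u i0) - f i z - 2 * (G * D)" by linarith
    then have inner: "2 * a * (h i \<bullet> (y - z)) \<ge> 2 * a * (f i (u i0) - f i z - 2 * (G * D))"
      using \<open>0 \<le> a\<close> by (intro mult_left_mono) auto
    \<comment> \<open>This removes the mixed term. The coefficient \<open>2 * G\<close> collects the
      two changes of point, and \<open>G\<^sup>2\<close> comes from the squared step.\<close>
    have "2 * a * D \<le> a\<^sup>2 + dispersion u"
      using sum_squares_bound[of a D] by (simp add: D2)
    then have "2 * G * (2 * a * D) \<le> 2 * G * (a\<^sup>2 + dispersion u)"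
      using \<open>0 \<le> G\<close> by (intro mult_left_mono) auto
    moreover have "a\<^sup>2 * (norm (h i))\<^sup>2 \<le> (a\<^sup>2 + dispersion u) * G\<^sup>2"
      using bound[of i] by (intro mult_mono power_mono) auto
    moreover have "(norm (y - z))\<^sup>2 \<le> (\<Sum>j\<in>UNIV. p i j * (norm (u j - z))\<^sup>2)"
      unfolding y_diff using row nonneg by (intro norm_power2_weighted_sum_le)
    moreover have "(norm (y - a *\<^sub>R h i - z))\<^sup>2
        = (norm (y - z))\<^sup>2 + a\<^sup>2 * (norm (h i))\<^sup>2 - 2 * a * (h i \<bullet> (y - z))"
      using norm_diff_power2[of "y - z" "a *\<^sub>R h i"]
      by (simp add: power_mult_distrib inner_commute algebra_simps)
    ultimately show ?thesis
      using inner unfolding y_def[symmetric] by (simp add: algebra_simps)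
  qed
  then have "(\<Sum>i\<in>UNIV. (norm ((\<Sum>j\<in>UNIV. p i j *\<^sub>R u j) - a *\<^sub>R h i - z))\<^sup>2)
      \<le> (\<Sum>i\<in>UNIV. (\<Sum>j\<in>UNIV. p i j * (norm (u j - z))\<^sup>2) - 2 * a * (f i (u i0) - f i z)
        + (2 * G + G\<^sup>2) * (a\<^sup>2 + dispersion u))"
    by (rule sum_mono)
  also have "\<dots> = (\<Sum>i\<in>UNIV. \<Sum>j\<in>UNIV. p i j * (norm (u j - z))\<^sup>2)
      - 2 * a * ((\<Sum>i\<in>UNIV. f i (u i0)) - (\<Sum>i\<in>UNIV. f i z))
      + real CARD('n) * (2 * G + G\<^sup>2) * (a\<^sup>2 + dispersion u)"
    by (simp add: sum.distrib sum_subtractf sum_distrib_left[symmetric])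
  finally show ?thesis .
qed

locale distributed_subgradient = perturbed_averaging M F w \<gamma> t0 x g \<alpha> G B
  for M :: "'a measure" and F :: "nat \<Rightarrow> 'a measure"
    and w :: "nat \<Rightarrow> 'n::finite \<Rightarrow> 'n \<Rightarrow> 'a \<Rightarrow> real" and \<gamma> :: real and t0 :: nat
    and x g :: "nat \<Rightarrow> 'n \<Rightarrow> 'a \<Rightarrow> 'b::euclidean_space" and \<alpha> :: "nat \<Rightarrow> real" and G :: real
    and B :: nat +
  fixes f :: "'n \<Rightarrow> 'b \<Rightarrow> real"
  assumes convex: "\<And>i. convex_on UNIV (f i)"
    and subgradient_bound: "\<And>i z h. subgradient (f i) z h \<Longrightarrow> norm h \<le> G"
    and g_subgradient: "\<And>t. t0 \<le> t \<Longrightarrow> AE \<omega> in M. \<forall>i. subgradient (f i) (x t i \<omega>) (g t i \<omega>)"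
    and alpha_not_summable: "\<not> summable \<alpha>"
begin

definition \<Phi> :: "'b \<Rightarrow> real" where "\<Phi> z = (\<Sum>i\<in>UNIV. f i z)"

lemma f_lipschitz: "\<bar>f i y - f i z\<bar> \<le> G * norm (y - z)"
  using convex subgradient_bound by (rule convex_on_lipschitz)

lemma f_continuous: "continuous_on UNIV (f i)"
  using convex by (intro convex_on_continuous) auto

lemma \<Phi>_continuous: "continuous_on UNIV \<Phi>"
  unfolding \<Phi>_def[abs_def] by (intro continuous_on_sum f_continuous)

lemma \<Phi>_ess_bounded:
  assumes "h \<in> ess_bounded M N"
  shows "(\<lambda>\<omega>. \<Phi> (h \<omega>)) \<in> ess_bounded M N"
  unfolding \<Phi>_def
proof (intro ess_bounded_sum)
  fix i
  obtain C where [measurable]: "h \<in> borel_measurable N" and C: "AE \<omega> in M. norm (h \<omega>) \<le> C"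
    using assms by (rule ess_boundedE)
  have [measurable]: "f i \<in> borel_measurable borel"
    by (rule borel_measurable_continuous_onI[OF f_continuous])
  from C have "AE \<omega> in M. norm (f i (h \<omega>)) \<le> \<bar>f i 0\<bar> + G * C"
  proof eventually_elim
    case (elim \<omega>)
    then have "G * norm (h \<omega>) \<le> G * C" using G_nonneg by (intro mult_left_mono)
    with f_lipschitz[of i "h \<omega>" 0] show ?case by simp
  qed
  then show "(\<lambda>\<omega>. f i (h \<omega>)) \<in> ess_bounded M N" by (intro ess_boundedI) measurable
qed

text \<open>The time from which \<open>exp_dispersion_summable\<close> applies; limits are
  insensitive to the times before it.\<close>

definition start :: nat where "start = t0 * B"

lemma start_ge: "t0 \<le> start"
  unfolding start_def using B_pos by (cases B) auto

lemma expected_drift: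
  assumes t: "t0 \<le> t" and A: "A \<in> sets (F t)"
  shows "(\<integral>\<omega>. indicator A \<omega> * (\<Sum>i\<in>UNIV. (norm (x (Suc t) i \<omega> - z))\<^sup>2) \<partial>M)
    \<le> (\<integral>\<omega>. indicator A \<omega> * ((\<Sum>i\<in>UNIV. (norm (x t i \<omega> - z))\<^sup>2)
        - 2 * \<alpha> t * (\<Phi> (x t i0 \<omega>) - \<Phi> z)
        + real CARD('n) * (2 * G + G\<^sup>2) * ((\<alpha> t)\<^sup>2 + dispersion (\<lambda>i. x t i \<omega>))) \<partial>M)"
proof -
  have t': "t0 \<le> Suc t" using t by simp
  define R where "R \<omega> = - 2 * \<alpha> t * (\<Phi> (x t i0 \<omega>) - \<Phi> z)
      + real CARD('n) * (2 * G + G\<^sup>2) * ((\<alpha> t)\<^sup>2 + dispersion (\<lambda>i. x t i \<omega>))" for \<omega>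
  \<comment> \<open>The indicator is placed next to the squared distances, so that the weights
    multiply factors known at time \<open>t\<close>, as \<open>expectation_column\<close>
    requires.\<close>
  define W where "W \<omega> = (\<Sum>i\<in>UNIV. \<Sum>j\<in>UNIV. w (Suc t) i j \<omega> * (indicator A \<omega> * (norm (x t j \<omega> - z))\<^sup>2))" for \<omega>
  note x = x_ess_bounded[OF t]
  note A' = ess_bounded_indicator[OF A]
  note up = ess_bounded_F_mono[of t "Suc t", simplified]
  have R: "R \<in> ess_bounded M (F t)"
    unfolding R_def[abs_def] by (intro ess_bounded_intros ess_bounded_dispersion \<Phi>_ess_bounded x)
  have AR_int: "integrable M (\<lambda>\<omega>. indicator A \<omega> * R \<omega>)"
    by (intro integrableI[of _ t] ess_bounded_intros A' R)
  have W_int: "integrable M W"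
    unfolding W_def[abs_def]
    by (intro integrableI[of _ "Suc t"] ess_bounded_intros w_ess_bounded[OF t'] up A' x)
  have "(\<integral>\<omega>. indicator A \<omega> * (\<Sum>i\<in>UNIV. (norm (x (Suc t) i \<omega> - z))\<^sup>2) \<partial>M)
      \<le> (\<integral>\<omega>. W \<omega> + indicator A \<omega> * R \<omega> \<partial>M)"
  proof (rule integral_mono_AE)
    show "integrable M (\<lambda>\<omega>. indicator A \<omega> * (\<Sum>i\<in>UNIV. (norm (x (Suc t) i \<omega> - z))\<^sup>2))"
      by (intro integrableI[of _ "Suc t"] ess_bounded_intros up[OF A'] x_ess_bounded[OF t'])
    show "AE \<omega> in M. indicator A \<omega> * (\<Sum>i\<in>UNIV. (norm (x (Suc t) i \<omega> - z))\<^sup>2) \<le> W \<omega> + indicator A \<omega> * R \<omega>"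
      using AE_space w_nonneg[OF t'] w_row[OF t'] g_subgradient[OF t] g_bound[OF t]
    proof eventually_elim
      case (elim \<omega>)
      have "(\<Sum>i\<in>UNIV. (norm (x (Suc t) i \<omega> - z))\<^sup>2)
          \<le> (\<Sum>i\<in>UNIV. \<Sum>j\<in>UNIV. w (Suc t) i j \<omega> * (norm (x t j \<omega> - z))\<^sup>2) + R \<omega>"
        using subgradient_step_drift[where p = "\<lambda>i j. w (Suc t) i j \<omega>" and u = "\<lambda>i. x t i \<omega>"
            and h = "\<lambda>i. g t i \<omega>" and f = f and a = "\<alpha> t" and G = G and z = z and ?i0.0 = i0]
          elim f_lipschitz alpha_nonneg[OF t]
        by (simp add: R_def x_step[OF t] avg_def \<Phi>_def)
      then show ?case
        by (simp add: W_def indicator_def)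
    qed
  qed (use W_int AR_int in simp)
  also have "\<dots> = (\<integral>\<omega>. W \<omega> \<partial>M) + (\<integral>\<omega>. indicator A \<omega> * R \<omega> \<partial>M)"
    using W_int AR_int by simp
  also have "(\<integral>\<omega>. W \<omega> \<partial>M) = (\<integral>\<omega>. (\<Sum>j\<in>UNIV. indicator A \<omega> * (norm (x t j \<omega> - z))\<^sup>2) \<partial>M)"
    unfolding W_def by (intro expectation_column[OF t] ess_bounded_intros A' x)
  also have "\<dots> + (\<integral>\<omega>. indicator A \<omega> * R \<omega> \<partial>M)
      = (\<integral>\<omega>. (\<Sum>j\<in>UNIV. indicator A \<omega> * (norm (x t j \<omega> - z))\<^sup>2) + indicator A \<omega> * R \<omega> \<partial>M)"
    by (intro Bochner_Integration.integral_add[symmetric] AR_int integrableI[of _ t] ess_bounded_intros A' x)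
  finally show ?thesis
    by (simp add: R_def sum_distrib_left[symmetric] algebra_simps)
qed

text \<open>Minimality of \<open>z\<close> makes the decrease term nonnegative, as Robbins-Siegmund
  demands. The exceptional null set depends on \<open>z\<close>, so only countably many
  \<open>z\<close> can be treated together.\<close>

lemma AE_convergent_distance:
  assumes z: "\<And>y. \<Phi> z \<le> \<Phi> y"
  shows "AE \<omega> in M. convergent (\<lambda>n. \<Sum>i\<in>UNIV. (norm (x (start + n) i \<omega> - z))\<^sup>2)
    \<and> summable (\<lambda>n. 2 * \<alpha> (start + n) * (\<Phi> (x (start + n) i0 \<omega>) - \<Phi> z))"
proof (rule robbins_siegmund[where F = "\<lambda>n. F (start + n)"
      and c = "\<lambda>n \<omega>. real CARD('n) * (2 * G + G\<^sup>2) * ((\<alpha> (start + n))\<^sup>2 + dispersion (\<lambda>i. x (start + n) i \<omega>))"])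
  have ge: "t0 \<le> start + n" for n using start_ge by simp
  note x = x_ess_bounded[OF ge]
  have V: "(\<lambda>\<omega>. \<Sum>i\<in>UNIV. (norm (x (start + n) i \<omega> - z))\<^sup>2) \<in> ess_bounded M (F (start + n))" for n
    by (intro ess_bounded_intros x)
  have b: "(\<lambda>\<omega>. 2 * \<alpha> (start + n) * (\<Phi> (x (start + n) i0 \<omega>) - \<Phi> z)) \<in> ess_bounded M (F (start + n))" for n
    by (intro ess_bounded_intros \<Phi>_ess_bounded x)
  have c: "(\<lambda>\<omega>. real CARD('n) * (2 * G + G\<^sup>2) * ((\<alpha> (start + n))\<^sup>2 + dispersion (\<lambda>i. x (start + n) i \<omega>)))
      \<in> ess_bounded M (F (start + n))" for n
    by (intro ess_bounded_intros ess_bounded_dispersion x)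
  show "subalgebra M (F (start + n))" for n by (rule subalg)
  show "sets (F (start + m)) \<subseteq> sets (F (start + n))" if "m \<le> n" for m n
    using F_mono[of "start + m" "start + n"] that by (simp add: subalgebra_def)
  show "(\<lambda>\<omega>. \<Sum>i\<in>UNIV. (norm (x (start + n) i \<omega> - z))\<^sup>2) \<in> borel_measurable (F (start + n))"
    "integrable M (\<lambda>\<omega>. \<Sum>i\<in>UNIV. (norm (x (start + n) i \<omega> - z))\<^sup>2)" for n
    using V by (rule ess_bounded_measurable integrableI)+
  show "(\<lambda>\<omega>. 2 * \<alpha> (start + n) * (\<Phi> (x (start + n) i0 \<omega>) - \<Phi> z)) \<in> borel_measurable (F (start + n))"
    "integrable M (\<lambda>\<omega>. 2 * \<alpha> (start + n) * (\<Phi> (x (start + n) i0 \<omega>) - \<Phi> z))" for n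
    using b by (rule ess_bounded_measurable integrableI)+
  show "(\<lambda>\<omega>. real CARD('n) * (2 * G + G\<^sup>2) * ((\<alpha> (start + n))\<^sup>2 + dispersion (\<lambda>i. x (start + n) i \<omega>)))
      \<in> borel_measurable (F (start + n))"
    "integrable M (\<lambda>\<omega>. real CARD('n) * (2 * G + G\<^sup>2) * ((\<alpha> (start + n))\<^sup>2 + dispersion (\<lambda>i. x (start + n) i \<omega>)))" for n
    using c by (rule ess_bounded_measurable integrableI)+
  show "0 \<le> 2 * \<alpha> (start + n) * (\<Phi> (x (start + n) i0 \<omega>) - \<Phi> z)" for n \<omega>
    using z alpha_nonneg[OF ge] by (intro mult_nonneg_nonneg) auto
  show "0 \<le> real CARD('n) * (2 * G + G\<^sup>2) * ((\<alpha> (start + n))\<^sup>2 + dispersion (\<lambda>i. x (start + n) i \<omega>))" for n \<omega>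
    using G_nonneg by (intro mult_nonneg_nonneg add_nonneg_nonneg) auto
  show "(\<integral>\<omega>. indicator A \<omega> * (\<Sum>i\<in>UNIV. (norm (x (start + Suc n) i \<omega> - z))\<^sup>2) \<partial>M)
    \<le> (\<integral>\<omega>. indicator A \<omega> * ((\<Sum>i\<in>UNIV. (norm (x (start + n) i \<omega> - z))\<^sup>2)
        - 2 * \<alpha> (start + n) * (\<Phi> (x (start + n) i0 \<omega>) - \<Phi> z)
        + real CARD('n) * (2 * G + G\<^sup>2) * ((\<alpha> (start + n))\<^sup>2 + dispersion (\<lambda>i. x (start + n) i \<omega>))) \<partial>M)"
    if "A \<in> sets (F (start + n))" for n A
    using expected_drift[OF ge that] by simp
  have "(\<integral>\<omega>. real CARD('n) * (2 * G + G\<^sup>2) * ((\<alpha> (start + n))\<^sup>2 + dispersion (\<lambda>i. x (start + n) i \<omega>)) \<partial>M)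
      = real CARD('n) * (2 * G + G\<^sup>2) * ((\<alpha> (start + n))\<^sup>2 + exp_dispersion (x (start + n)))" for n
  proof -
    have "integrable M (\<lambda>\<omega>. dispersion (\<lambda>i. x (start + n) i \<omega>))"
      by (intro integrableI[of _ "start + n"] ess_bounded_dispersion x)
    then show ?thesis by (simp add: exp_dispersion_def prob_space)
  qed
  then show "summable (\<lambda>n. \<integral>\<omega>. real CARD('n) * (2 * G + G\<^sup>2)
      * ((\<alpha> (start + n))\<^sup>2 + dispersion (\<lambda>i. x (start + n) i \<omega>)) \<partial>M)"
    using alpha_square_summable_shift exp_dispersion_summable
    by (simp only: start_def) (intro summable_mult summable_add)
qed (auto intro: sum_nonneg)

theorem AE_consensus_at_minimizer:
  assumes minimizer: "\<And>y. \<Phi> z0 \<le> \<Phi> y"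
  shows "AE \<omega> in M. \<exists>z. \<Phi> z = \<Phi> z0 \<and> (\<forall>i. (\<lambda>t. x t i \<omega>) \<longlonglongrightarrow> z)"
proof -
  have ge: "t0 \<le> start + n" for n using start_ge by simp
  obtain D where D: "countable D" "D \<subseteq> {z. \<Phi> z = \<Phi> z0}" "{z. \<Phi> z = \<Phi> z0} \<subseteq> closure D"
    by (rule separable)
  have D_nonempty: "D \<noteq> {}" using D(3) by auto
  \<comment> \<open>Any node will do: the objective is followed at one node, and the dispersion
    takes care of the others.\<close>
  define i0 :: 'n where "i0 = undefined"
  have "AE \<omega> in M. \<forall>z\<in>D. convergent (\<lambda>n. \<Sum>i\<in>UNIV. (norm (x (start + n) i \<omega> - z))\<^sup>2)
      \<and> summable (\<lambda>n. 2 * \<alpha> (start + n) * (\<Phi> (x (start + n) i0 \<omega>) - \<Phi> z))"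
  proof (rule AE_ball_countable[THEN iffD2, OF D(1)], rule ballI)
    fix z assume "z \<in> D"
    then have "\<Phi> z \<le> \<Phi> y" for y using D(2) minimizer by auto
    then show "AE \<omega> in M. convergent (\<lambda>n. \<Sum>i\<in>UNIV. (norm (x (start + n) i \<omega> - z))\<^sup>2)
        \<and> summable (\<lambda>n. 2 * \<alpha> (start + n) * (\<Phi> (x (start + n) i0 \<omega>) - \<Phi> z))"
      by (rule AE_convergent_distance)
  qed
  moreover have "AE \<omega> in M. summable (\<lambda>n. dispersion (\<lambda>i. x (start + n) i \<omega>))"
  proof (rule AE_summable_of_summable_integral)
    show "integrable M (\<lambda>\<omega>. dispersion (\<lambda>i. x (start + n) i \<omega>))" for n
      by (intro integrableI[of _ "start + n"] ess_bounded_dispersion x_ess_bounded ge)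
    show "summable (\<lambda>n. \<integral>\<omega>. dispersion (\<lambda>i. x (start + n) i \<omega>) \<partial>M)"
      using exp_dispersion_summable by (simp add: exp_dispersion_def start_def)
  qed simp
  ultimately show ?thesis
  proof eventually_elim
    case (elim \<omega>)
    have "\<exists>z. \<Phi> z = \<Phi> z0 \<and> (\<forall>i. (\<lambda>n. x (start + n) i \<omega>) \<longlonglongrightarrow> z)"
    proof (rule consensus_at_minimizer[where D = D and a = "\<lambda>n. 2 * \<alpha> (start + n)" and ?i0.0 = i0])
      obtain z where "z \<in> D" using D_nonempty by blast
      with D(2) elim(1) show "summable (\<lambda>n. 2 * \<alpha> (start + n) * (\<Phi> (x (start + n) i0 \<omega>) - \<Phi> z0))"
        by fastforce
      show "\<not> summable (\<lambda>n. 2 * \<alpha> (start + n))"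
        using alpha_not_summable summable_iff_shift[of \<alpha> start] by (simp add: add.commute)
      show "(\<lambda>n. dispersion (\<lambda>i. x (start + n) i \<omega>)) \<longlonglongrightarrow> 0"
        using elim(2) by (rule summable_LIMSEQ_zero)
    qed (use \<Phi>_continuous minimizer D D_nonempty elim alpha_nonneg[OF ge] in auto)
    then show ?case
      by (auto simp: add.commute[of start] LIMSEQ_ignore_initial_segment dest!: LIMSEQ_offset)
  qed
qed

end

section \<open>From the hypotheses on matrices and step sizes to the locales\<close>

lemma not_summable_of_divergent_tail:
  fixes \<alpha> :: "nat \<Rightarrow> real"
  assumes "filterlim (\<lambda>T. \<Sum>t=t0..T. \<alpha> t) at_top sequentially" and nonneg: "\<And>t. t0 \<le> t \<Longrightarrow> 0 \<le> \<alpha> t"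
  shows "\<not> summable \<alpha>"
proof
  assume "summable \<alpha>"
  \<comment> \<open>Terms before \<open>t0\<close> may have any sign, so the comparison is made on
    the tail.\<close>
  then have tail: "summable (\<lambda>n. \<alpha> (n + t0))" by (subst summable_iff_shift)
  have bound: "(\<Sum>t=t0..T. \<alpha> t) \<le> (\<Sum>n. \<alpha> (n + t0))" for T
  proof -
    have "(\<Sum>t=t0..T. \<alpha> t) = (\<Sum>n<Suc T - t0. \<alpha> (n + t0))"
      by (rule sum.reindex_bij_witness[of _ "\<lambda>n. n + t0" "\<lambda>t. t - t0"]) auto
    also have "\<dots> \<le> (\<Sum>n. \<alpha> (n + t0))"
      using nonneg by (intro sum_le_suminf[OF tail]) auto
    finally show ?thesis .
  qed
  have "\<forall>\<^sub>F T in sequentially. (\<Sum>n. \<alpha> (n + t0)) < (\<Sum>t=t0..T. \<alpha> t)"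
    using assms(1) by (simp add: filterlim_at_top_dense)
  then obtain T where "(\<Sum>n. \<alpha> (n + t0)) < (\<Sum>t=t0..T. \<alpha> t)"
    using eventually_happens'[OF sequentially_bot] by blast
  with bound[of T] show False by simp
qed

lemma row_stochastic_row_sum:
  assumes "row_stochastic A"
  shows "(\<Sum>j\<in>UNIV. A $ i $ j) = 1"
proof -
  have "(A *v 1) $ i = 1" using assms by (simp add: row_stochastic_def)
  then show ?thesis by (simp add: matrix_vector_mult_def)
qed

lemma column_stochastic_column_sum:
  assumes "column_stochastic A"
  shows "(\<Sum>i\<in>UNIV. A $ i $ j) = 1"
proof -
  have "(1 v* A) $ j = 1" using assms by (simp add: column_stochastic_def)
  then show ?thesis by (simp add: vector_matrix_mult_def)
qed

theorem theorem1:
  fixes M :: "'a measure"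
    and \<F> :: "nat \<Rightarrow> 'a measure"
    and W :: "nat \<Rightarrow> 'a \<Rightarrow> real^'n^'n"
    and f :: "'n \<Rightarrow> real^'m \<Rightarrow> real"
    and F :: "real^'m \<Rightarrow> real"
    and Z :: "(real^'m) set"
    and L :: "'n \<Rightarrow> real"
    and \<gamma> K \<beta> :: real
    and t0 B :: nat
    and \<alpha> :: "nat \<Rightarrow> real"
    and x0 :: "'n \<Rightarrow> real^'m"
    and x g :: "nat \<Rightarrow> 'n \<Rightarrow> 'a \<Rightarrow> real^'m"
  defines "F \<equiv> \<lambda>z. \<Sum>i\<in>UNIV. f i z"
  defines "Z \<equiv> {z. is_arg_min F (\<lambda>_. True) z}"
  assumes prob: "prob_space M"
    and filtration: "filtration (space M) \<F>" "\<And>t. subalgebra M (\<F> t)"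
    and gamma: "0 < \<gamma>" "\<gamma> < 1"
    and convex: "\<And>i. convex_on UNIV (f i)"
    and Z_nonempty: "Z \<noteq> {}"
    and subgradient_bound: "\<And>i z h. subgradient (f i) z h \<Longrightarrow> infnorm h \<le> L i"
    and W_adapted: "\<And>t. W t \<in> borel_measurable (\<F> t)"
    and W_row: "\<And>t. t \<ge> t0 \<Longrightarrow> AE \<omega> in M. row_stochastic (W t \<omega>)"
    and W_column: "\<And>t. t > t0 \<Longrightarrow>
          AE \<omega> in M. column_stochastic (matrix_cond_exp M (\<F> (t - 1)) (W t) \<omega>)"
    and self_loops: "\<And>t. t \<ge> t0 \<Longrightarrow> AE \<omega> in M. \<forall>i. (i, i) \<in> edges \<gamma> (W t \<omega>)"
    and B_pos: "B > 0"
    and B_connected: "\<And>t. t \<ge> t0 \<Longrightarrow>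
          AE \<omega> in M. has_spanning_rooted_tree
            (\<Union>\<tau>\<in>{t * B + 1..(t + 1) * B}. edges \<gamma> (matrix_cond_exp M (\<F> (t * B)) (W \<tau>) \<omega>))"
    and K_beta_pos: "K > 0" "\<beta> > 0"
    and alpha_pos: "\<And>t. t \<ge> t0 \<Longrightarrow> 0 < \<alpha> t"
    and alpha_le: "\<And>t. t \<ge> t0 \<Longrightarrow> t > 0 \<Longrightarrow> \<alpha> t \<le> K * real t powr (- \<beta>)"
    and alpha_ratio: "(\<lambda>t. \<alpha> t / \<alpha> (t + 1)) \<longlonglongrightarrow> 1"
    and alpha_sum: "filterlim (\<lambda>T. \<Sum>t=t0..T. \<alpha> t) at_top sequentially"
    and alpha_square_sum: "summable (\<lambda>t. (\<alpha> (t0 + t))\<^sup>2)"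
    and x_init: "\<And>i \<omega>. \<omega> \<in> space M \<Longrightarrow> x t0 i \<omega> = x0 i"
    and x_step: "\<And>t i \<omega>. t \<ge> t0 \<Longrightarrow> \<omega> \<in> space M \<Longrightarrow>
          x (t + 1) i \<omega> = (\<Sum>j\<in>UNIV. W (t + 1) \<omega> $ i $ j *\<^sub>R x t j \<omega>) - \<alpha> t *\<^sub>R g t i \<omega>"
    and g_measurable: "\<And>t i. t \<ge> t0 \<Longrightarrow> g t i \<in> borel_measurable (\<F> t)"
    and g_subgradient: "\<And>t i. t \<ge> t0 \<Longrightarrow> AE \<omega> in M. subgradient (f i) (x t i \<omega>) (g t i \<omega>)"
  shows "\<exists>z \<in> borel_measurable M.
           (AE \<omega> in M. z \<omega> \<in> Z) \<and>
           (AE \<omega> in M. \<forall>i. (\<lambda>t. x t i \<omega>) \<longlonglongrightarrow> z \<omega>)"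
proof -
  interpret prob_space M by (rule prob)
  have space_F: "space (\<F> t) = space M" for t
    using filtration(2)[of t] by (simp add: subalgebra_def)
  \<comment> \<open>The square root of the dimension converts the sup norm into the Euclidean norm,
    and the sum of the \<open>\<bar>L i\<bar>\<close> is a common bound for all nodes.\<close>
  define G where "G = sqrt DIM(real^'m) * (\<Sum>i\<in>UNIV. \<bar>L i\<bar>)"
  have norm_le_G: "norm h \<le> G" if "subgradient (f i) z h" for i z h
  proof -
    have "infnorm h \<le> \<bar>L i\<bar>"
      using subgradient_bound[OF that] by simp
    also have "\<dots> \<le> (\<Sum>i\<in>UNIV. \<bar>L i\<bar>)" by (rule member_le_sum) auto
    finally have "sqrt DIM(real^'m) * infnorm h \<le> G" unfolding G_def by (rule mult_left_mono) simp
    with norm_le_infnorm[of h] show ?thesis by simp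
  qed
  have sub_AE: "AE \<omega> in M. \<forall>i. subgradient (f i) (x t i \<omega>) (g t i \<omega>)" if "t0 \<le> t" for t
    using g_subgradient[OF that] by (simp add: AE_all_countable)
  define w where "w t i j \<omega> = W t \<omega> $ i $ j" for t i j \<omega>
  interpret random_averaging M \<F> w \<gamma> t0
  proof
    show "subalgebra (\<F> t) (\<F> s)" if "s \<le> t" for s t
      using filtration.sets_F_mono[OF filtration(1) that] by (simp add: subalgebra_def space_F)
    show "w t i j \<in> borel_measurable (\<F> t)" for t i j
    proof -
      have "(\<lambda>A::real^'n^'n. A $ i $ j) \<in> borel_measurable borel"
        by (intro borel_measurable_continuous_onI continuous_intros)
      from measurable_compose[OF W_adapted this] show ?thesis by (simp add: w_def[abs_def])
    qed
    fix t assume t: "t0 \<le> t"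
    show "AE \<omega> in M. \<forall>i j. 0 \<le> w t i j \<omega>"
      using W_row[OF t] by eventually_elim (simp add: row_stochastic_def w_def)
    show "AE \<omega> in M. \<forall>i. (\<Sum>j\<in>UNIV. w t i j \<omega>) = 1"
      using W_row[OF t] by eventually_elim (simp add: w_def row_stochastic_row_sum)
    show "AE \<omega> in M. \<forall>i. \<gamma> \<le> w t i i \<omega>"
      using self_loops[OF t] by eventually_elim (simp add: edges_def w_def less_imp_le)
    have "AE \<omega> in M. column_stochastic (matrix_cond_exp M (\<F> t) (W (Suc t)) \<omega>)"
      using W_column[of "Suc t"] t by simp
    then show "AE \<omega> in M. \<forall>j. (\<Sum>i\<in>UNIV. real_cond_exp M (\<F> t) (w (Suc t) i j) \<omega>) = 1"
    proof eventually_elim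
      case (elim \<omega>)
      show ?case
        using column_stochastic_column_sum[OF elim] by (simp add: matrix_cond_exp_def w_def[abs_def])
    qed
  qed (use filtration(2) gamma in auto)
  interpret distributed_subgradient M \<F> w \<gamma> t0 x g \<alpha> G B f
  proof
    show "x t0 i \<in> ess_bounded M (\<F> t0)" for i
    proof (rule ess_boundedI)
      show "x t0 i \<in> borel_measurable (\<F> t0)"
        by (rule measurable_cong[THEN iffD2, OF _ measurable_const[of "x0 i"]])
           (simp_all add: space_F x_init)
      show "AE \<omega> in M. norm (x t0 i \<omega>) \<le> norm (x0 i)"
        using AE_space by eventually_elim (simp add: x_init)
    qed
    show "x (Suc t) i \<omega> = avg (Suc t) (x t) i \<omega> - \<alpha> t *\<^sub>R g t i \<omega>"
      if "t0 \<le> t" "\<omega> \<in> space M" for t i \<omega>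
      using x_step[OF that, of i] by (simp add: avg_def w_def)
    show "AE \<omega> in M. \<forall>i. norm (g t i \<omega>) \<le> G" if "t0 \<le> t" for t
      using sub_AE[OF that] by eventually_elim (auto intro: norm_le_G)
    show "0 \<le> G" unfolding G_def by (intro mult_nonneg_nonneg sum_nonneg) auto
    show "connected_window (t * B) B" if t: "t0 \<le> t" for t
    proof -
      have window: "{t * B + 1..(t + 1) * B} = (\<lambda>k. Suc (t * B + k)) ` {..<B}"
      proof (intro set_eqI iffI)
        fix \<tau> assume "\<tau> \<in> {t * B + 1..(t + 1) * B}"
        then show "\<tau> \<in> (\<lambda>k. Suc (t * B + k)) ` {..<B}"
          by (intro image_eqI[of _ _ "\<tau> - Suc (t * B)"]) auto
      qed auto
      have "(\<Union>\<tau>\<in>{t * B + 1..(t + 1) * B}. edges \<gamma> (matrix_cond_exp M (\<F> (t * B)) (W \<tau>) \<omega>))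
          = (\<Union>k<B. {(j, i). \<gamma> < real_cond_exp M (\<F> (t * B)) (w (Suc (t * B + k)) i j) \<omega>})" for \<omega>
        unfolding window by (simp add: edges_def matrix_cond_exp_def w_def[abs_def])
      then show ?thesis
        using B_connected[OF t] by (simp add: connected_window_def)
    qed
    show "\<not> summable \<alpha>"
      using alpha_sum alpha_pos by (rule not_summable_of_divergent_tail[OF _ less_imp_le])
  qed (use g_measurable alpha_pos alpha_square_sum B_pos convex norm_le_G sub_AE in
      \<open>auto intro: less_imp_le\<close>)
  have F_eq: "F = \<Phi>" by (simp add: F_def \<Phi>_def fun_eq_iff)
  obtain z0 where "z0 \<in> Z" using Z_nonempty by blast
  then have minimal: "\<Phi> z0 \<le> \<Phi> y" for y
    by (simp add: Z_def is_arg_min_def F_eq not_less)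
  have Z_iff: "z \<in> Z \<longleftrightarrow> \<Phi> z = \<Phi> z0" for z
    using minimal by (auto simp: Z_def is_arg_min_def F_eq not_less intro: antisym)
  define i0 :: 'n where "i0 = undefined"
  \<comment> \<open>A limit taken by \<open>lim\<close> is measurable even where the sequence
    diverges. The shift by \<open>t0\<close> is essential: measurability of the iterates is known
    only from \<open>t0\<close> on.\<close>
  define z where "z \<omega> = lim (\<lambda>k. x (t0 + k) i0 \<omega>)" for \<omega>
  have "AE \<omega> in M. z \<omega> \<in> Z \<and> (\<forall>i. (\<lambda>t. x t i \<omega>) \<longlonglongrightarrow> z \<omega>)"
    using AE_consensus_at_minimizer[OF minimal]
  proof eventually_elim
    case (elim \<omega>)
    then obtain y where y: "\<Phi> y = \<Phi> z0" "\<And>i. (\<lambda>t. x t i \<omega>) \<longlonglongrightarrow> y" by blast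
    have "(\<lambda>k. x (t0 + k) i0 \<omega>) \<longlonglongrightarrow> y"
      using LIMSEQ_ignore_initial_segment[OF y(2), of t0] by (simp add: add.commute)
    then have "z \<omega> = y" unfolding z_def by (rule limI)
    with y show ?case by (simp add: Z_iff)
  qed
  moreover have "z \<in> borel_measurable M"
  proof -
    have "x (t0 + k) i0 \<in> borel_measurable M" for k
      by (rule measurable_from_subalg[OF filtration(2) ess_bounded_measurable[OF x_ess_bounded]]) simp
    then show ?thesis unfolding z_def[abs_def] by (rule borel_measurable_lim_metric)
  qed
  ultimately show ?thesis by auto
qed

end
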